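(* Let $F:\mathbb{R}^d\to\mathbb{R}$ and $\varphi:\mathbb{R}^d\to\mathbb{R}$ be differentiable, let $\gamma>0$, let $\nabla f(x,\xi)$ be a stochastic gradient of $F$, and let $\{p_k\}_{k\ge 0}$, $\{q_k\}_{k\ge 0}$ be generated by the scheme given in the context. Assume the following. (a) $\lim_{\|x\|_2\to\infty}F(x)=\infty$; there is $F_*>-\infty$ with $F(x)\ge F_*$ for all $x$; with $\Lambda=\{q:\nabla F(q)=0\}$, the set $F(\Lambda)\cap K$ is finite for every compact $K\subset\mathbb{R}$; and $\mathbb{E}[\nabla f(x,\xi)]=\nabla F(x)$ for all $x$. (b) There is $\lambda>0$ with $\|\nabla\varphi(y)-\nabla\varphi(x)\|_2\le\lambda\|x-y\|_2$ for all $x,y$; $\varphi(y)-\varphi(x)\le\langle\nabla\varphi(y),y-x\rangle$ for all $x,y$; $\lim_{\|x\|_2\to\infty}\varphi(x)=\infty$; and $\varphi(x)\ge\varphi_*>-\infty$ for all $x$. (c) $\alpha_0=0$, $\alpha_k>0$ for $k\ge1$, $\sum_k\alpha_k=\infty$ and $\sum_k\alpha_k^2<\infty$. (d) At least one of the following three settings holds. Setting 1: there is $L>0$ with $\|\nabla F(y)-\nabla F(x)\|_2\le L\|x-y\|_2$ for all $x,y$, and there are $\kappa,\tau,\sigma\ge0$ with $\mathbb{V}[\nabla f(x,\xi)]\le\kappa(F(x)-F_* )+\tau\|\nabla F(x)\|_2^2+\sigma^2$ for all $x$. Setting 2: $F$ is $(L_0,L_1)$-smooth; $\mathbb{V}[\nabla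 f(x,\xi)]\le\sigma^2$ for all $x$; and there is $\Delta>0$ with $\|\nabla\varphi(x)\|_2\le\Delta$ for all $x\in\mathbb{R}^d$. Setting 3: $F$ is $(L_0,L_1)$-smooth; there is $\Delta>0$ with $\|\nabla\varphi(x)\|_2\le\Delta$ for all $x\in\mathbb{R}^d$; $F=\frac1N\sum_{i=1}^N f_i$ and $f(q,\xi)=\frac{1}{|B_\xi|}\sum_{i\in B_\xi}f_i(q)$, $\nabla f(q,\xi)=\frac{1}{|B_{\xi}|}\sum_{i\in B_\xi}\nabla f_i(q)$, where $B_\xi\subset\{1,\dots,N\}$ is a (nonempty) random subset determined by $\xi$ and $\inf_{q}f_i(q)>-\infty$ for each $i$; $\mathbb{E}[\|\nabla f(x,\xi)-\nabla F(x)\|_2]\le\sigma$ for all $x$; and for each $\xi$, $f(\cdot,\xi)$ is $(L_0,L_1)$-smooth. Then $\{q_k\}_{k\ge0}$ converges almost surely to the set of stationary points of $F$, i.e. $\inf_{x\in\Lambda}\|q_k-x\|_2\to0$ almost surely. If in addition the stationary points of $F$ are isolated, then almost surely $\{q_k\}_{k\ge 0}$ converges to a single stationary point of $F$.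
   Context: $(\Omega,\mathcal{F},\mathbb{P})$ is a probability space and $\{\xi_k\}_{k\ge0}$ is a sequence of independent, identically distributed random variables on it; $\xi$ denotes a generic variable with the same distribution. The scheme is $$p_{k+1}=p_k-\alpha_k\nabla f(q_k,\xi_k)-\alpha_k\gamma\nabla\varphi(p_k),\qquad q_{k+1}=q_k+\alpha_k\nabla\varphi(p_{k+1}),$$ with $p_0=0$ and $q_0\in\mathbb{R}^d$ arbitrary (deterministic). $\mathbb{V}[\nabla f(x,\xi)]=\mathbb{E}[\|\nabla f(x,\xi)\|_2^2]-\|\nabla F(x)\|_2^2$. A differentiable function $G:\mathbb{R}^d\to\mathbb{R}$ is $(L_0,L_1)$-smooth (with constants $L_0\ge0$, $L_1>0$) if $\|\nabla G(x)-\nabla G(y)\|_2\le(L_0+L_1\|\nabla G(y)\|_2)\|x-y\|_2$ whenever $\|x-y\|_2\le 1/L_1$. *)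

theory Defs
  imports "HOL-Probability.Probability"
begin

definition grad :: "('a::real_inner \<Rightarrow> real) \<Rightarrow> 'a \<Rightarrow> 'a" where
  "grad G x = (THE D. GDERIV G x :> D)"

lemma grad_eq:
  fixes G :: "'a::real_inner \<Rightarrow> real"
  assumes "GDERIV G x :> D"
  shows "grad G x = D"
  unfolding grad_def
proof (rule the_equality)
  show "GDERIV G x :> D" by (rule assms)
next
  fix D' assume "GDERIV G x :> D'"
  then have "(\<lambda>h. inner h D') = (\<lambda>h. inner h D)"
    using assms unfolding gderiv_def by (rule has_derivative_unique)
  then have "inner (D' - D) (D' - D) = 0"
    by (metis inner_diff_right right_minus_eq)
  then show "D' = D" by simp
qed

lemma GDERIV_grad:
  fixes G :: "'a::euclidean_space \<Rightarrow> real"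
  assumes "G differentiable (at x)"
  shows "GDERIV G x :> grad G x"
proof -
  obtain D where D: "(G has_derivative D) (at x)"
    using assms unfolding differentiable_def by blast
  then have "linear D" by (rule has_derivative_linear)
  then have "D = (\<lambda>h. inner h (adjoint D 1))"
    by (simp add: adjoint_works)
  then have "GDERIV G x :> adjoint D 1"
    using D unfolding gderiv_def by simp
  then show ?thesis using grad_eq by metis
qed

definition stationary_points :: "('a::real_inner \<Rightarrow> real) \<Rightarrow> 'a set" where
  "stationary_points G = {x. grad G x = 0}"

definition L0L1_smooth :: "real \<Rightarrow> real \<Rightarrow> ('a::real_inner \<Rightarrow> real) \<Rightarrow> bool" where
  "L0L1_smooth L0 L1 G \<longleftrightarrow> 0 \<le> L0 \<and> 0 < L1 \<and> (\<forall>x. G differentiable (at x)) \<and>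
     (\<forall>x y. norm (x - y) \<le> 1 / L1 \<longrightarrow>
        norm (grad G x - grad G y) \<le> (L0 + L1 * norm (grad G y)) * norm (x - y))"

text \<open>
  Throughout, \<open>M\<close> is the underlying probability space, \<open>\<xi>\<close> the generic random variable, \<open>F\<close> the
  objective, and \<open>g x s\<close> stands for the stochastic gradient \<open>\<nabla>f(x, s)\<close>.
\<close>

text \<open>
  The Bochner integral of a non-integrable function is 0, so this is the variance only where
  \<open>norm (g x \<xi>)\<close> is square integrable; variance bounds below are therefore stated together with
  square integrability.
\<close>

definition grad_variance ::
  "'w measure \<Rightarrow> ('w \<Rightarrow> 's) \<Rightarrow> ('a::real_inner \<Rightarrow> real) \<Rightarrow> ('a \<Rightarrow> 's \<Rightarrow> 'a) \<Rightarrow> 'a \<Rightarrow> real" where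
  "grad_variance M \<xi> F g x = (\<integral>\<omega>. (norm (g x (\<xi> \<omega>)))\<^sup>2 \<partial>M) - (norm (grad F x))\<^sup>2"

definition setting1 ::
  "'w measure \<Rightarrow> ('w \<Rightarrow> 's) \<Rightarrow> (real ^ 'd \<Rightarrow> real) \<Rightarrow> real \<Rightarrow> (real ^ 'd \<Rightarrow> 's \<Rightarrow> real ^ 'd) \<Rightarrow> bool" where
  "setting1 M \<xi> F Fstar g \<longleftrightarrow>
     (\<exists>L>0. \<forall>x y. norm (grad F y - grad F x) \<le> L * norm (x - y)) \<and>
     (\<exists>\<kappa>\<ge>0. \<exists>\<tau>\<ge>0. \<exists>\<sigma>\<ge>0. \<forall>x.
        integrable M (\<lambda>\<omega>. (norm (g x (\<xi> \<omega>)))\<^sup>2) \<and>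
        grad_variance M \<xi> F g x \<le> \<kappa> * (F x - Fstar) + \<tau> * (norm (grad F x))\<^sup>2 + \<sigma>\<^sup>2)"

definition setting2 ::
  "'w measure \<Rightarrow> ('w \<Rightarrow> 's) \<Rightarrow> (real ^ 'd \<Rightarrow> real) \<Rightarrow> (real ^ 'd \<Rightarrow> real)
     \<Rightarrow> (real ^ 'd \<Rightarrow> 's \<Rightarrow> real ^ 'd) \<Rightarrow> bool" where
  "setting2 M \<xi> F \<phi> g \<longleftrightarrow>
     (\<exists>L0 L1. L0L1_smooth L0 L1 F) \<and>
     (\<exists>\<sigma>\<ge>0. \<forall>x. integrable M (\<lambda>\<omega>. (norm (g x (\<xi> \<omega>)))\<^sup>2) \<and> grad_variance M \<xi> F g x \<le> \<sigma>\<^sup>2) \<and>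
     (\<exists>\<Delta>>0. \<forall>x. norm (grad \<phi> x) \<le> \<Delta>)"

text \<open>
  In the third setting \<open>\<xi>\<close> takes values in the measurable space \<open>S\<close>, and the mini-batch is a
  measurable function \<open>B\<close> of that value. The objective and the samples are smooth with common
  constants.
\<close>

definition setting3 ::
  "'w measure \<Rightarrow> 's measure \<Rightarrow> ('w \<Rightarrow> 's) \<Rightarrow> (real ^ 'd \<Rightarrow> real) \<Rightarrow> (real ^ 'd \<Rightarrow> real)
     \<Rightarrow> (real ^ 'd \<Rightarrow> 's \<Rightarrow> real ^ 'd) \<Rightarrow> bool" where
  "setting3 M S \<xi> F \<phi> g \<longleftrightarrow>
     (\<exists>\<Delta>>0. \<forall>x. norm (grad \<phi> x) \<le> \<Delta>) \<and>
     (\<exists>\<sigma>\<ge>0. \<forall>x. (\<integral>\<omega>. norm (g x (\<xi> \<omega>) - grad F x) \<partial>M) \<le> \<sigma>) \<and>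
     (\<exists>L0 L1 N. \<exists>fi :: nat \<Rightarrow> real ^ 'd \<Rightarrow> real. \<exists>B :: 's \<Rightarrow> nat set.
        L0L1_smooth L0 L1 F \<and>
        N \<ge> 1 \<and>
        (\<forall>i\<in>{1..N}. (\<forall>x. fi i differentiable (at x)) \<and> bdd_below (range (fi i))) \<and>
        (\<forall>x. F x = (1 / real N) * (\<Sum>i\<in>{1..N}. fi i x)) \<and>
        B \<in> measurable S (count_space UNIV) \<and>
        (\<forall>s\<in>space S. B s \<subseteq> {1..N} \<and> B s \<noteq> {} \<and>
           (\<forall>x. g x s = (1 / real (card (B s))) *\<^sub>R (\<Sum>i\<in>B s. grad (fi i) x)) \<and>
           L0L1_smooth L0 L1 (\<lambda>x. (1 / real (card (B s))) * (\<Sum>i\<in>B s. fi i x))))"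

end

theory Submission
  imports Defs
begin

text \<open>
  The energy \<open>W = 1 + (F q - F\<^sub>*) + (\<phi> p - \<phi>\<^sub>*)\<close> satisfies, for small \<open>\<alpha>\<^sub>k\<close>,
  \<open>E[W\<^sub>k\<^sub>+\<^sub>1 | past] \<le> (1 + c \<alpha>\<^sub>k\<^sup>2) W\<^sub>k - \<gamma> \<alpha>\<^sub>k \<parallel>\<nabla>\<phi>(p\<^sub>k)\<parallel>\<^sup>2\<close> in each of the three settings: the
  noise term has mean \<open>O(\<alpha>\<^sub>k\<^sup>2)\<close> because \<open>\<nabla>\<phi>(p\<^sub>k\<^sub>+\<^sub>1)\<close> differs from \<open>\<nabla>\<phi>(p\<^sub>k)\<close> by
  \<open>O(\<alpha>\<^sub>k)\<close> only, and these second-order terms grow at most linearly in \<open>W\<close>. After normalisation \<open>W\<close>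
  becomes a nonnegative supermartingale, and the maximal inequality makes the iterates bounded and
  \<open>\<Sum> \<alpha>\<^sub>k \<parallel>\<nabla>\<phi>(p\<^sub>k)\<parallel>\<^sup>2\<close> finite almost surely; the same inequality shows that the accumulated noise
  \<open>\<Sum> \<alpha>\<^sub>k (\<nabla>f(q\<^sub>k, \<xi>\<^sub>k) - \<nabla>F(q\<^sub>k))\<close> converges. Pathwise, \<open>\<nabla>\<phi>(p\<^sub>k) \<rightarrow> 0\<close> follows; then \<open>q\<close> is
  almost constant over long windows, over which \<open>p\<close> would drift linearly if \<open>\<nabla>F(q\<^sub>k)\<close> were not small,
  so \<open>\<nabla>F(q\<^sub>k) \<rightarrow> 0\<close> by boundedness of \<open>p\<close>. Finally \<open>q\<^sub>k\<^sub>+\<^sub>1 - q\<^sub>k \<rightarrow> 0\<close> prevents \<open>q\<close> from jumping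
  between isolated stationary points.
\<close>

section \<open>Smoothness\<close>

text \<open>The position moves along the gradient at the new momentum P = p_{k+1}, so the
  first-order change of F pairs grad F(q_k) with grad \<phi>(P). Convexity of \<phi>, applied at P
  and not at p_k, pairs the momentum step with the same vector. The deterministic gradient parts
  then cancel, and friction and the pairing of grad \<phi>(P) with the noise remain. The obstacle is
  that P depends on the current sample, so this pairing is not centred. Replacing grad \<phi>(P) by
  grad \<phi>(p_k) costs \<alpha>^2 times a product of two random norms. Bounding the mean of that
  product by the energy is the main task in each setting; with only a first moment of the deviation,
  one factor has to be bounded pointwise. Two localisations follow. The energy estimate starts at an
  index K where the energy is finite but not known to be integrable, so supermartingales are
  \<open>ennreal\<close>-valued and the maximal inequality is restricted to sets where the start is
  bounded. The noise variance is bounded only over bounded sets of positions, so the noise is summed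
  after truncation to balls.\<close>

lemma mean_value_grad:
  fixes G :: "'a::euclidean_space \<Rightarrow> real"
  assumes "\<And>x. G differentiable (at x)"
  shows "\<exists>t\<in>{0<..<1}. G (x + h) - G x = inner (grad G (x + t *\<^sub>R h)) h"
proof -
  have "((\<lambda>t. G (x + t *\<^sub>R h)) has_derivative (\<lambda>s. inner (s *\<^sub>R h) (grad G (x + t *\<^sub>R h))))
      (at t within {0..1})" for t
  proof -
    have "(G has_derivative (\<lambda>h'. inner h' (grad G (x + t *\<^sub>R h)))) (at (x + t *\<^sub>R h))"
      using GDERIV_grad[OF assms] unfolding gderiv_def .
    moreover have "((\<lambda>t. x + t *\<^sub>R h) has_derivative (\<lambda>s. s *\<^sub>R h)) (at t within {0..1})"
      by (auto intro!: derivative_eq_intros)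
    ultimately show ?thesis
      by (rule has_derivative_compose[rotated])
  qed
  from mvt_simple[of 0 1 "\<lambda>t. G (x + t *\<^sub>R h)", OF _ this]
  show ?thesis by (auto simp: inner_commute)
qed

text \<open>The gradient is compared only with its value at the centre x, within radius
  \<open>norm h\<close>, as \<open>L0L1_smooth\<close> permits. Using the mean value theorem instead
  of an integral remainder costs a factor: the constant is c and not c/2.\<close>

lemma descent_of_local_lipschitz:
  fixes G :: "'a::euclidean_space \<Rightarrow> real"
  assumes diff: "\<And>x. G differentiable (at x)"
    and lip: "\<And>y. norm (y - x) \<le> norm h \<Longrightarrow> norm (grad G y - grad G x) \<le> c * norm (y - x)"
    and c: "0 \<le> c"
  shows "G (x + h) \<le> G x + inner (grad G x) h + c * (norm h)\<^sup>2"
proof -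
  obtain t where t: "t \<in> {0<..<1}" "G (x + h) - G x = inner (grad G (x + t *\<^sub>R h)) h"
    using mean_value_grad[OF diff] by blast
  have th: "norm (t *\<^sub>R h) \<le> norm h"
    using t(1) by (simp add: mult_left_le_one_le)
  have "inner (grad G (x + t *\<^sub>R h)) h
      = inner (grad G x) h + inner (grad G (x + t *\<^sub>R h) - grad G x) h"
    by (simp add: inner_diff_left)
  also have "inner (grad G (x + t *\<^sub>R h) - grad G x) h
      \<le> norm (grad G (x + t *\<^sub>R h) - grad G x) * norm h"
    by (rule norm_cauchy_schwarz)
  also have "\<dots> \<le> (c * norm (t *\<^sub>R h)) * norm h"
    using lip[of "x + t *\<^sub>R h"] th by (intro mult_right_mono) auto
  also have "\<dots> \<le> (c * norm h) * norm h"
    using th c by (intro mult_right_mono mult_left_mono) auto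
  finally show ?thesis using t(2) by (simp add: power2_eq_square)
qed

text \<open>The step of size 1/(2L) against the gradient minimises the quadratic upper bound; it
  lowers G by at least the squared gradient over 4L, yet G cannot fall below m.\<close>

lemma grad_sq_le_of_lipschitz:
  fixes G :: "'a::euclidean_space \<Rightarrow> real"
  assumes diff: "\<And>x. G differentiable (at x)"
    and lip: "\<And>x y. norm (grad G y - grad G x) \<le> L * norm (x - y)" and L: "0 < L"
    and lower: "\<And>x. m \<le> G x"
  shows "(norm (grad G x))\<^sup>2 \<le> 4 * L * (G x - m)"
proof -
  define h where "h = - (1 / (2 * L)) *\<^sub>R grad G x"
  have "m \<le> G (x + h)" by (rule lower)
  also have "\<dots> \<le> G x + inner (grad G x) h + L * (norm h)\<^sup>2"
    using lip[of x] L by (intro descent_of_local_lipschitz[OF diff]) (auto simp: norm_minus_commute)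
  also have "inner (grad G x) h = - (norm (grad G x))\<^sup>2 / (2 * L)"
    by (simp add: h_def power2_norm_eq_inner)
  also have "L * (norm h)\<^sup>2 = (norm (grad G x))\<^sup>2 / (4 * L)"
    using L by (simp add: h_def power2_eq_square field_simps)
  finally show ?thesis using L by (simp add: field_simps)
qed

lemma L0L1_smooth_descent:
  fixes G :: "'a::euclidean_space \<Rightarrow> real"
  assumes sm: "L0L1_smooth L0 L1 G" and h: "norm h \<le> 1 / L1"
  shows "G (x + h) \<le> G x + inner (grad G x) h + (L0 + L1 * norm (grad G x)) * (norm h)\<^sup>2"
  using sm h unfolding L0L1_smooth_def by (intro descent_of_local_lipschitz) auto

text \<open>If the gradient norm n exceeds L0/L1, a gradient step of size 1/(2b) with b = L0 + L1 n
  has length n/(2b), inside the smoothness radius, and gains n^2/(4b). As b < 2 L1 n, the gain is at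
  least n/(8 L1). Hence linear growth in the gap, against a square root in the Lipschitz
  case.\<close>

lemma L0L1_smooth_grad_le:
  fixes G :: "'a::euclidean_space \<Rightarrow> real"
  assumes sm: "L0L1_smooth L0 L1 G" and lower: "\<And>x. m \<le> G x"
  shows "norm (grad G x) \<le> L0 / L1 + 8 * L1 * (G x - m)"
proof (cases "L1 * norm (grad G x) \<le> L0")
  case True
  have L: "0 \<le> L0" "0 < L1" using sm by (auto simp: L0L1_smooth_def)
  then have "norm (grad G x) \<le> L0 / L1" using True by (simp add: field_simps)
  moreover have "0 \<le> 8 * L1 * (G x - m)" using L lower[of x] by simp
  ultimately show ?thesis by linarith
next
  case False
  have L: "0 \<le> L0" "0 < L1" using sm by (auto simp: L0L1_smooth_def)
  define n where "n = norm (grad G x)"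
  have n: "L0 < L1 * n" "0 < n" using False L
    by (auto simp: n_def)
  define b where "b = L0 + L1 * n"
  have b: "0 < b" "L1 * n \<le> b" "b < 2 * L1 * n" using L n by (auto simp: b_def)
  define h where "h = - (1 / (2 * b)) *\<^sub>R grad G x"
  have nh: "norm h = n / (2 * b)" using b by (simp add: h_def n_def)
  have "n / (2 * b) \<le> 1 / L1"
    using b L n by (simp add: field_simps)
  then have "m \<le> G x + inner (grad G x) h + b * (norm h)\<^sup>2"
    using L0L1_smooth_descent[OF sm, of h x] lower[of "x + h"] nh by (simp add: b_def n_def)
  also have "inner (grad G x) h = - n\<^sup>2 / (2 * b)"
    by (simp add: h_def power2_norm_eq_inner n_def)
  also have "b * (norm h)\<^sup>2 = n\<^sup>2 / (4 * b)"
    using b by (simp add: nh power2_eq_square field_simps)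
  finally have "n\<^sup>2 \<le> 4 * b * (G x - m)" using b by (simp add: field_simps)
  also have "\<dots> \<le> 4 * (2 * L1 * n) * (G x - m)"
    using b lower[of x] by (intro mult_right_mono mult_left_mono) auto
  finally have "n * n \<le> n * (8 * L1 * (G x - m))" by (simp add: power2_eq_square algebra_simps)
  then have "n \<le> 8 * L1 * (G x - m)" using n by simp
  then show ?thesis using L by (simp add: n_def add_increasing)
qed

text \<open>Gives continuity of the gradient in the Lipschitz case, for \<phi> and for F in the
  first setting; the radius 1 is an arbitrary choice.\<close>

lemma L0L1_smooth_of_lipschitz:
  fixes G :: "'a::euclidean_space \<Rightarrow> real"
  assumes "\<And>x. G differentiable (at x)"
    and "\<And>x y. norm (grad G y - grad G x) \<le> L * norm (x - y)" and "0 < L"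
  shows "L0L1_smooth L 1 G"
  unfolding L0L1_smooth_def
proof (intro conjI allI impI)
  fix x y
  have "norm (grad G x - grad G y) \<le> L * norm (x - y)"
    using assms(2)[of y x] by (simp add: norm_minus_commute)
  also have "\<dots> \<le> (L + 1 * norm (grad G y)) * norm (x - y)"
    by (intro mult_right_mono) auto
  finally show "norm (grad G x - grad G y) \<le> (L + 1 * norm (grad G y)) * norm (x - y)" .
qed (use assms in auto)

lemma L0L1_smooth_continuous_grad:
  fixes G :: "'a::euclidean_space \<Rightarrow> real"
  assumes sm: "L0L1_smooth L0 L1 G"
  shows "continuous_on UNIV (grad G)"
proof (rule continuous_at_imp_continuous_on, rule ballI)
  fix x
  have L: "0 \<le> L0" "0 < L1" using sm by (auto simp: L0L1_smooth_def)
  define c where "c = L0 + L1 * norm (grad G x)"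
  have "((\<lambda>y. grad G y - grad G x) \<longlongrightarrow> 0) (at x)"
  proof (rule Lim_null_comparison)
    have "\<forall>\<^sub>F y in at x. dist y x < 1 / L1" 
      using L by (auto simp: eventually_at intro!: exI[of _ "1 / L1"])
    then show "\<forall>\<^sub>F y in at x. norm (grad G y - grad G x) \<le> c * norm (y - x)"
      using sm by (elim eventually_mono) (auto simp: L0L1_smooth_def c_def dist_norm)
    have "((\<lambda>y. c * norm (y - x)) \<longlongrightarrow> c * norm (x - x)) (at x)" by (intro tendsto_intros)
    then show "((\<lambda>y. c * norm (y - x)) \<longlongrightarrow> 0) (at x)" by simp
  qed
  then show "isCont (grad G) x" by (simp add: isCont_def Lim_null[symmetric])
qed

section \<open>Pathwise convergence\<close>

text \<open>Take the first index at which the mass accumulated from m reaches T. Minimality keeps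
  every proper prefix below T, so the overshoot is at most one step.\<close>

lemma divergent_window:
  fixes a :: "nat \<Rightarrow> real"
  assumes nonneg: "\<And>k. 0 \<le> a k" and div: "filterlim (\<lambda>n. \<Sum>k<n. a k) at_top sequentially"
    and T: "0 < T"
  obtains n where "m < n" "T \<le> (\<Sum>k=m..<n. a k)"
    "\<And>k. m \<le> k \<Longrightarrow> k < n \<Longrightarrow> (\<Sum>j=m..<k. a j) < T"
proof -
  have split: "(\<Sum>k=m..<n. a k) = (\<Sum>k<n. a k) - (\<Sum>k<m. a k)" if "m \<le> n" for n
    using sum_diff_nat_ivl[of 0 m n a] that by (simp add: atLeast0LessThan)
  have "\<forall>\<^sub>F n in sequentially. T + (\<Sum>k<m. a k) \<le> (\<Sum>k<n. a k)"
    using div by (simp add: filterlim_at_top)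
  then have "\<forall>\<^sub>F n in sequentially. T + (\<Sum>k<m. a k) \<le> (\<Sum>k<n. a k) \<and> m \<le> n"
    using eventually_ge_at_top[of m] by eventually_elim auto
  then obtain n' where n': "T + (\<Sum>k<m. a k) \<le> (\<Sum>k<n'. a k)" "m \<le> n'"
    by (auto dest: eventually_happens)
  define P where "P n \<longleftrightarrow> m \<le> n \<and> T \<le> (\<Sum>k=m..<n. a k)" for n
  have ex: "P n'" using n' split by (auto simp: P_def)
  define n where "n = (LEAST n. P n)"
  have n: "P n" unfolding n_def using ex by (rule LeastI)
  have least: "\<not> P k" if "k < n" for k using that not_less_Least unfolding n_def by blast
  show thesis
  proof (rule that[of n])
    show "m < n" using n T by (cases "m = n") (auto simp: P_def)
    show "T \<le> (\<Sum>k=m..<n. a k)" using n by (simp add: P_def)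
    show "(\<Sum>j=m..<k. a j) < T" if "m \<le> k" "k < n" for k
      using least[OF that(2)] that by (auto simp: P_def not_le)
  qed
qed

lemma telescope_ivl:
  fixes x :: "nat \<Rightarrow> 'a::real_vector"
  assumes "\<And>k. x (Suc k) = x k + d k" and "m \<le> n"
  shows "x n - x m = (\<Sum>k=m..<n. d k)"
proof -
  have "(\<Sum>k=m..<n. d k) = (\<Sum>k=m..<n. x (Suc k) - x k)"
    by (simp add: assms(1))
  then show ?thesis using sum_Suc_diff'[OF assms(2), of x] by simp
qed

lemma Cauchy_tail_ivl:
  fixes d :: "nat \<Rightarrow> 'a::real_normed_vector"
  assumes "Cauchy (\<lambda>n. \<Sum>k<n. d k)" and "0 < e"
  shows "\<exists>N. \<forall>m\<ge>N. \<forall>n\<ge>m. norm (\<Sum>k=m..<n. d k) < e"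
proof -
  obtain N where N: "\<And>m n. m \<ge> N \<Longrightarrow> n \<ge> N \<Longrightarrow> dist (\<Sum>k<m. d k) (\<Sum>k<n. d k) < e"
    using assms unfolding Cauchy_def by metis
  have "norm (\<Sum>k=m..<n. d k) < e" if "m \<ge> N" "n \<ge> m" for m n
  proof -
    have "(\<Sum>k=m..<n. d k) = (\<Sum>k<n. d k) - (\<Sum>k<m. d k)"
      using sum_diff_nat_ivl[of 0 m n d] that by (simp add: atLeast0LessThan)
    then show ?thesis using N[of n m] that by (simp add: dist_norm)
  qed
  then show ?thesis by blast
qed

lemma summable_tail_ivl:
  fixes f :: "nat \<Rightarrow> real"
  assumes "summable f" and "0 < e"
  shows "\<exists>N. \<forall>m\<ge>N. \<forall>n\<ge>m. (\<Sum>k=m..<n. f k) < e"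
proof -
  have "Cauchy (\<lambda>n. \<Sum>k<n. f k)"
    using assms(1) by (simp add: summable_iff_convergent Cauchy_convergent_iff)
  from Cauchy_tail_ivl[OF this assms(2)] show ?thesis
    by (auto simp: abs_less_iff)
qed

text \<open>
  If \<open>G\<close> is large at \<open>x\<^sub>m\<close>, it stays large over a window of step mass \<open>T\<close>, whose length does not
  depend on \<open>m\<close>: this contradicts the summability of \<open>a\<^sub>k \<parallel>G x\<^sub>k\<parallel>\<^sup>2\<close>.
\<close>

lemma lipschitz_field_tendsto_zero:
  fixes x b d :: "nat \<Rightarrow> 'a::real_normed_vector" and G :: "'a \<Rightarrow> 'b::real_normed_vector"
  assumes nonneg: "\<And>k. 0 \<le> a k" and div: "filterlim (\<lambda>n. \<Sum>k<n. a k) at_top sequentially"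
    and step: "\<And>k. x (Suc k) = x k + a k *\<^sub>R b k + d k"
    and b: "\<And>k. norm (b k) \<le> B"
    and noise: "Cauchy (\<lambda>n. \<Sum>k<n. d k)"
    and lip: "\<And>u v. norm (G u - G v) \<le> l * norm (u - v)" and l: "0 < l"
    and sq: "summable (\<lambda>k. a k * (norm (G (x k)))\<^sup>2)"
  shows "(\<lambda>k. G (x k)) \<longlonglongrightarrow> 0"
proof (rule LIMSEQ_I)
  fix r :: real assume "0 < r"
  define e where "e = r / 2"
  have e: "0 < e" using \<open>0 < r\<close> by (simp add: e_def)
  have B: "0 \<le> B" using b[of 0] norm_ge_zero order_trans by blast
  \<comment> \<open>Within a window the drift moves x by at most B T and the noise by e/(2l), so G
    changes by at most e/2 + e/2. The summand 1 keeps the divisor positive when B = 0.\<close>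
  define T where "T = e / (2 * l * (B + 1))"
  have T: "0 < T" using e l B by (simp add: T_def)
  have TB: "l * (B * T) \<le> e / 2"
  proof -
    have "l * (B * T) \<le> l * ((B + 1) * T)" using l T by (intro mult_left_mono mult_right_mono) auto
    also have "\<dots> = e / 2" using l B by (simp add: T_def field_simps add_nonneg_eq_0_iff)
    finally show ?thesis .
  qed
  have "0 < e / (2 * l)" "0 < e\<^sup>2 * T" using e l T by auto
  then obtain N1 N2 where N1: "\<And>m n. m \<ge> N1 \<Longrightarrow> n \<ge> m \<Longrightarrow> norm (\<Sum>k=m..<n. d k) < e / (2 * l)"
    and N2: "\<And>m n. m \<ge> N2 \<Longrightarrow> n \<ge> m \<Longrightarrow> (\<Sum>k=m..<n. a k * (norm (G (x k)))\<^sup>2) < e\<^sup>2 * T"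
    using Cauchy_tail_ivl[OF noise] summable_tail_ivl[OF sq] by metis
  have "norm (G (x m)) < r" if m: "m \<ge> max N1 N2" for m
  proof (rule ccontr)
    assume "\<not> norm (G (x m)) < r"
    then have big: "2 * e \<le> norm (G (x m))" by (simp add: e_def)
    obtain n where n: "m < n" "T \<le> (\<Sum>k=m..<n. a k)"
      "\<And>k. m \<le> k \<Longrightarrow> k < n \<Longrightarrow> (\<Sum>j=m..<k. a j) < T"
      using divergent_window[OF nonneg div T] by blast
    have ge: "e \<le> norm (G (x k))" if k: "m \<le> k" "k < n" for k
    proof -
      have "x k - x m = (\<Sum>j=m..<k. a j *\<^sub>R b j + d j)"
        using step k(1) by (intro telescope_ivl) (auto simp: add.assoc)
      also have "\<dots> = (\<Sum>j=m..<k. a j *\<^sub>R b j) + (\<Sum>j=m..<k. d j)" by (rule sum.distrib)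
      finally have "norm (x k - x m) \<le> norm (\<Sum>j=m..<k. a j *\<^sub>R b j) + norm (\<Sum>j=m..<k. d j)"
        by (simp add: norm_triangle_ineq)
      also have "norm (\<Sum>j=m..<k. a j *\<^sub>R b j) \<le> (\<Sum>j=m..<k. a j * B)"
        using nonneg b by (intro sum_norm_le) (auto intro: mult_left_mono)
      also have "(\<Sum>j=m..<k. a j * B) = B * (\<Sum>j=m..<k. a j)" by (simp add: sum_distrib_left mult.commute)
      also have "\<dots> \<le> B * T" using n(3)[OF k] B by (intro mult_left_mono) auto
      also have "norm (\<Sum>j=m..<k. d j) \<le> e / (2 * l)" using N1[of m k] m k by auto
      finally have "l * norm (x k - x m) \<le> l * (B * T + e / (2 * l))"
        using l by (intro mult_left_mono) auto
      also have "\<dots> \<le> e" using TB l by (simp add: distrib_left)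
      finally have "norm (G (x k) - G (x m)) \<le> e" using lip[of "x k" "x m"] by linarith
      then show ?thesis using big norm_triangle_ineq2[of "G (x m)" "G (x k)"]
        by (simp add: norm_minus_commute)
    qed
    \<comment> \<open>A window of mass T on which the norm of G is at least e uses up the whole tail
      allowance e^2 T fixed in \<open>N2\<close>.\<close>
    have "e\<^sup>2 * T \<le> e\<^sup>2 * (\<Sum>k=m..<n. a k)" using n(2) by (intro mult_left_mono) auto
    also have "\<dots> = (\<Sum>k=m..<n. a k * e\<^sup>2)" by (simp add: sum_distrib_right mult.commute)
    also have "\<dots> \<le> (\<Sum>k=m..<n. a k * (norm (G (x k)))\<^sup>2)"
      using ge e nonneg by (intro sum_mono mult_left_mono power_mono) auto
    also have "\<dots> < e\<^sup>2 * T" using N2[of m n] m n(1) by auto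
    finally show False by simp
  qed
  then show "\<exists>no. \<forall>n\<ge>no. norm (G (x n) - 0) < r" by (auto intro!: exI[of _ "max N1 N2"])
qed

text \<open>
  While \<open>G (x\<^sub>k)\<close> is small, \<open>y\<close> barely moves, so \<open>x\<close> drifts by \<open>T \<parallel>H (y\<^sub>m)\<parallel>\<close> over a window of step mass
  \<open>T\<close>; as \<open>x\<close> is bounded and \<open>T\<close> arbitrary, \<open>H (y\<^sub>m)\<close> must be small.
\<close>

lemma driving_field_tendsto_zero:
  fixes x y c d :: "nat \<Rightarrow> 'a::euclidean_space" and H :: "'a \<Rightarrow> 'a"
  assumes nonneg: "\<And>k. 0 \<le> a k" and div: "filterlim (\<lambda>n. \<Sum>k<n. a k) at_top sequentially"
    and a1: "\<And>k. a k \<le> A"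
    and x_step: "\<And>k. x (Suc k) = x k - a k *\<^sub>R H (y k) - a k *\<^sub>R c k + d k"
    and y_step: "\<And>k. y (Suc k) = y k + a k *\<^sub>R b k"
    and c: "c \<longlonglongrightarrow> 0" and b: "b \<longlonglongrightarrow> 0"
    and noise: "Cauchy (\<lambda>n. \<Sum>k<n. d k)"
    and H: "continuous_on UNIV H"
    and x_bd: "\<And>k. norm (x k) \<le> R" and y_bd: "\<And>k. norm (y k) \<le> R"
  shows "(\<lambda>k. H (y k)) \<longlonglongrightarrow> 0"
proof (rule LIMSEQ_I)
  fix r :: real assume "0 < r"
  define e where "e = r / 3"
  have e: "0 < e" using \<open>0 < r\<close> by (simp add: e_def)
  have R: "0 \<le> R" using x_bd[of 0] norm_ge_zero order_trans by blast
  have A: "0 \<le> A" using a1[of 0] nonneg[of 0] by linarith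
  have "uniformly_continuous_on (cball 0 R) H"
    using H by (intro compact_uniformly_continuous) (auto intro: continuous_on_subset)
  then obtain \<delta> where \<delta>: "0 < \<delta>" "\<And>u v. norm u \<le> R \<Longrightarrow> norm v \<le> R \<Longrightarrow> norm (u - v) < \<delta> \<Longrightarrow> norm (H u - H v) < e"
    using e unfolding uniformly_continuous_on_def
    by (metis dist_norm mem_cball_0)
  \<comment> \<open>With mass s of the window, a drift of at least 3 e s has to be covered by 2R
    from the two endpoints, e s from the variation of H, and 1 each from the damping and the noise.
    So 2 e s is at most 2R + 2, while T makes it at least 2R + 4.\<close>
  define T where "T = (R + 2) / e"
  have T: "0 < T" "e * T = R + 2" using e R by (auto simp: T_def)
  \<comment> \<open>The last step may overshoot T, by at most A; \<open>\<eta>\<close> below is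
    small relative to this upper bound on the mass, so that y stays within \<delta> and the damping
    contributes at most 1.\<close>
  define T' where "T' = T + A"
  have T': "0 < T'" using T A by (simp add: T'_def)
  define \<eta> where "\<eta> = min \<delta> 1 / (2 * T')"
  have \<eta>: "0 < \<eta>" "\<eta> * T' < \<delta>" "\<eta> * T' \<le> 1" using \<delta>(1) T' by (auto simp: \<eta>_def)
  obtain N1 N2 N3 where N1: "\<And>m n. m \<ge> N1 \<Longrightarrow> n \<ge> m \<Longrightarrow> norm (\<Sum>k=m..<n. d k) < 1"
    and N2: "\<And>k. k \<ge> N2 \<Longrightarrow> norm (c k) < \<eta>" and N3: "\<And>k. k \<ge> N3 \<Longrightarrow> norm (b k) < \<eta>"
    using Cauchy_tail_ivl[OF noise, of 1] LIMSEQ_D[OF c \<eta>(1)] LIMSEQ_D[OF b \<eta>(1)]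
    by (metis diff_zero zero_less_one)
  have "norm (H (y m)) < r" if m: "m \<ge> max N1 (max N2 N3)" for m
  proof (rule ccontr)
    assume "\<not> norm (H (y m)) < r"
    then have big: "3 * e \<le> norm (H (y m))" by (simp add: e_def)
    obtain n where n: "m < n" "T \<le> (\<Sum>k=m..<n. a k)"
      "\<And>k. m \<le> k \<Longrightarrow> k < n \<Longrightarrow> (\<Sum>j=m..<k. a j) < T"
      using divergent_window[OF nonneg div T(1)] by blast
    define \<Sigma> where "\<Sigma> = (\<Sum>k=m..<n. a k)"
    have \<Sigma>: "T \<le> \<Sigma>" "\<Sigma> \<le> T'"
    proof -
      obtain n' where n': "n = Suc n'" "m \<le> n'" using n(1) by (cases n) auto
      then have "\<Sigma> = (\<Sum>k=m..<n'. a k) + a n'" by (simp add: \<Sigma>_def)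
      then show "\<Sigma> \<le> T'" using n(3)[of n'] n' a1[of n'] by (simp add: T'_def)
    qed (use n in \<open>simp add: \<Sigma>_def\<close>)
    have bound: "norm (\<Sum>j=m..<k. a j *\<^sub>R f j) \<le> \<eta> * T'"
      if k: "m \<le> k" "k \<le> n" and f: "\<And>j. j \<ge> m \<Longrightarrow> norm (f j) < \<eta>" for f :: "nat \<Rightarrow> 'a" and k
    proof -
      have "norm (\<Sum>j=m..<k. a j *\<^sub>R f j) \<le> (\<Sum>j=m..<k. a j * \<eta>)"
        using nonneg f[THEN less_imp_le] by (intro sum_norm_le) (auto intro!: mult_left_mono)
      also have "\<dots> \<le> (\<Sum>j=m..<n. a j * \<eta>)"
        using k nonneg \<eta> by (intro sum_mono2) auto
      also have "\<dots> = \<eta> * \<Sigma>" by (simp add: \<Sigma>_def sum_distrib_left mult.commute)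
      also have "\<dots> \<le> \<eta> * T'" using \<Sigma> \<eta> by (intro mult_left_mono) auto
      finally show ?thesis .
    qed
    have near: "norm (H (y k) - H (y m)) < e" if k: "m \<le> k" "k < n" for k
    proof (rule \<delta>(2)[OF y_bd y_bd])
      have "y k - y m = (\<Sum>j=m..<k. a j *\<^sub>R b j)"
        using y_step k by (intro telescope_ivl) auto
      then show "norm (y k - y m) < \<delta>"
        using bound[of k b] k m N3 \<eta>(2) by fastforce
    qed
    have "x n - x m = (\<Sum>k=m..<n. - (a k *\<^sub>R H (y k)) - a k *\<^sub>R c k + d k)"
      using x_step n(1) by (intro telescope_ivl) auto
    also have "\<dots> = - (\<Sum>k=m..<n. a k *\<^sub>R H (y k)) - (\<Sum>k=m..<n. a k *\<^sub>R c k) + (\<Sum>k=m..<n. d k)"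
      by (simp add: sum.distrib sum_subtractf sum_negf)
    \<comment> \<open>Freeze H at the start of the window; the error terms are the ones bounded in
      \<open>near\<close>.\<close>
    also have "(\<Sum>k=m..<n. a k *\<^sub>R H (y k)) = \<Sigma> *\<^sub>R H (y m) + (\<Sum>k=m..<n. a k *\<^sub>R (H (y k) - H (y m)))"
      by (simp add: \<Sigma>_def scaleR_diff_right sum_subtractf scaleR_sum_left)
    finally have eq: "\<Sigma> *\<^sub>R H (y m) = x m - x n - (\<Sum>k=m..<n. a k *\<^sub>R (H (y k) - H (y m)))
        - (\<Sum>k=m..<n. a k *\<^sub>R c k) + (\<Sum>k=m..<n. d k)" by (simp add: algebra_simps)
    have tri: "norm (u1 - u2 - u3 - u4 + u5) \<le> norm u1 + norm u2 + norm u3 + norm u4 + norm u5"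
      for u1 u2 u3 u4 u5 :: 'a
      using norm_triangle_ineq[of "u1 - u2 - u3 - u4" u5] norm_triangle_ineq4[of "u1 - u2 - u3" u4]
        norm_triangle_ineq4[of "u1 - u2" u3] norm_triangle_ineq4[of u1 u2] by linarith
    have "\<Sigma> * (3 * e) \<le> \<Sigma> * norm (H (y m))" using big \<Sigma> T by (intro mult_left_mono) auto
    also have "\<dots> = norm (\<Sigma> *\<^sub>R H (y m))" using \<Sigma> T by simp
    also have "\<dots> \<le> norm (x m) + norm (x n) + norm (\<Sum>k=m..<n. a k *\<^sub>R (H (y k) - H (y m)))
        + norm (\<Sum>k=m..<n. a k *\<^sub>R c k) + norm (\<Sum>k=m..<n. d k)"
      unfolding eq by (rule tri)
    also have "norm (\<Sum>k=m..<n. a k *\<^sub>R c k) \<le> \<eta> * T'"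
      using bound[of n c] n(1) m N2 by auto
    also have "norm (\<Sum>k=m..<n. a k *\<^sub>R (H (y k) - H (y m))) \<le> (\<Sum>k=m..<n. a k * e)"
      using nonneg near[THEN less_imp_le] by (intro sum_norm_le) (auto intro!: mult_left_mono)
    also have "(\<Sum>k=m..<n. a k * e) = \<Sigma> * e" by (simp add: \<Sigma>_def sum_distrib_right)
    also have "norm (\<Sum>k=m..<n. d k) \<le> 1" using N1[of m n] m n(1) by auto
    finally have "\<Sigma> * (2 * e) \<le> 2 * R + 2" using x_bd[of m] x_bd[of n] \<eta>(3) by (simp add: algebra_simps)
    moreover have "T * (2 * e) \<le> \<Sigma> * (2 * e)" using \<Sigma> e by (intro mult_right_mono) auto
    ultimately show False using T(2) by (simp add: algebra_simps)
  qed
  then show "\<exists>no. \<forall>n\<ge>no. norm (H (y n) - 0) < r"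
    by (auto intro!: exI[of _ "max N1 (max N2 N3)"])
qed

text \<open>Otherwise a subsequence keeps distance e from all zeros, but its accumulation points are
  zeros by continuity. In particular a zero exists.\<close>

lemma bounded_seq_near_zeros:
  fixes y :: "nat \<Rightarrow> 'a::euclidean_space" and H :: "'a \<Rightarrow> 'b::real_normed_vector"
  assumes H: "continuous_on UNIV H" and bd: "\<And>k. norm (y k) \<le> R"
    and lim: "(\<lambda>k. H (y k)) \<longlonglongrightarrow> 0" and e: "0 < e"
  shows "\<forall>\<^sub>F k in sequentially. \<exists>z. H z = 0 \<and> dist (y k) z < e"
proof (rule ccontr)
  assume "\<not> ?thesis"
  then obtain f :: "nat \<Rightarrow> nat"
    where f: "strict_mono f" "\<And>k. \<not> (\<exists>z. H z = 0 \<and> dist (y (f k)) z < e)"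
    using not_eventually_sequentiallyD by force
  have "compact (cball (0::'a) R)" by simp
  then obtain l h where l: "strict_mono h" "((y \<circ> f) \<circ> h) \<longlonglongrightarrow> l"
    using bd unfolding compact_def by (metis comp_apply dist_0_norm mem_cball)
  have "(\<lambda>k. H (((y \<circ> f) \<circ> h) k)) \<longlonglongrightarrow> H l"
    using H l(2) by (intro isCont_tendsto_compose[of _ H]) (simp_all add: continuous_on_eq_continuous_at o_def)
  moreover have "(\<lambda>k. H (((y \<circ> f) \<circ> h) k)) \<longlonglongrightarrow> 0"
    using LIMSEQ_subseq_LIMSEQ[OF lim strict_mono_o[OF f(1) l(1)]] by (simp add: o_def)
  ultimately have "H l = 0" by (rule LIMSEQ_unique)
  moreover have "\<exists>k. dist (y (f (h k))) l < e"
    using l(2) e unfolding lim_sequentially by auto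
  ultimately show False using f(2) by blast
qed

text \<open>The hypothesis names actual points of Z, so it excludes the empty set, for which
  \<open>infdist\<close> is 0 by convention.\<close>

lemma infdist_tendsto_zero:
  assumes "\<And>e. 0 < e \<Longrightarrow> \<forall>\<^sub>F k in sequentially. \<exists>z\<in>Z. dist (y k) z < e"
  shows "(\<lambda>k. infdist (y k) Z) \<longlonglongrightarrow> 0"
proof (rule tendstoI)
  fix e :: real assume "0 < e"
  from assms[OF this] show "\<forall>\<^sub>F k in sequentially. dist (infdist (y k) Z) 0 < e"
  proof eventually_elim
    case (elim k)
    then obtain z where z: "z \<in> Z" "dist (y k) z < e" by blast
    then have "infdist (y k) Z < e" using infdist_le[OF z(1), of "y k"] by linarith
    then show ?case by (simp add: infdist_nonneg)
  qed
qed

text \<open>A trap around an accumulation point x: within 2e of x the only nearby point of Z is x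
  itself, so the distance is in fact below e; and a step shorter than e cannot leave the
  2e-ball.\<close>

lemma converges_to_isolated_point:
  fixes y :: "nat \<Rightarrow> 'a::euclidean_space"
  assumes near: "\<And>e. 0 < e \<Longrightarrow> \<forall>\<^sub>F k in sequentially. \<exists>z\<in>Z. dist (y k) z < e"
    and Z: "closed Z" and bd: "\<And>k. norm (y k) \<le> R"
    and steps: "(\<lambda>k. dist (y (Suc k)) (y k)) \<longlonglongrightarrow> 0"
    and isol: "\<And>x. x \<in> Z \<Longrightarrow> x isolated_in Z"
  shows "\<exists>x\<in>Z. y \<longlonglongrightarrow> x"
proof -
  have "compact (cball (0::'a) R)" by simp
  then obtain x f where f: "strict_mono f" "(y \<circ> f) \<longlonglongrightarrow> x"
    using bd unfolding compact_def by (metis dist_0_norm mem_cball)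
  have "x \<in> closure Z"
  proof (subst closure_approachable, intro allI impI)
    fix e :: real assume e: "0 < e"
    then have e2: "0 < e / 2" by simp
    have "\<forall>\<^sub>F k in sequentially. \<exists>z\<in>Z. dist (y (f k)) z < e / 2"
      using eventually_subseq[OF f(1) near[OF e2]] .
    moreover have "\<forall>\<^sub>F k in sequentially. dist (y (f k)) x < e / 2"
      using tendstoD[OF f(2) e2] by simp
    ultimately have "\<forall>\<^sub>F k in sequentially. \<exists>z\<in>Z. dist z x < e"
    proof eventually_elim
      case (elim k)
      then obtain z where z: "z \<in> Z" "dist (y (f k)) z < e / 2" by blast
      with elim(2) have "dist z x < e"
        using dist_triangle3[of z x "y (f k)"] by linarith
      with z show ?case by blast
    qed
    then show "\<exists>z\<in>Z. dist z x < e" by (auto dest: eventually_happens)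
  qed
  then have x: "x \<in> Z" using Z by simp
  then obtain r where r: "0 < r" "\<And>z. z \<in> Z \<Longrightarrow> dist x z < r \<Longrightarrow> z = x"
    using isol[OF x] by (auto simp: isolated_in_dist_Ex_iff)
  have "y \<longlonglongrightarrow> x"
  proof (rule tendstoI)
    fix e0 :: real assume "0 < e0"
    \<comment> \<open>A point of Z within e of the sequence, while the sequence is within 2e of x,
      lies within 3e < r of x and hence equals x.\<close>
    define e where "e = min e0 (r / 4)"
    have e: "0 < e" "e \<le> e0" "4 * e \<le> r" using \<open>0 < e0\<close> r by (auto simp: e_def)
    have "\<forall>\<^sub>F k in sequentially. (\<exists>z\<in>Z. dist (y k) z < e) \<and> dist (y (Suc k)) (y k) < e"
      using near[OF e(1)] tendstoD[OF steps e(1)] by eventually_elim auto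
    then obtain N where N: "\<And>k. k \<ge> N \<Longrightarrow> \<exists>z\<in>Z. dist (y k) z < e"
      "\<And>k. k \<ge> N \<Longrightarrow> dist (y (Suc k)) (y k) < e"
      unfolding eventually_sequentially by blast
    have pull: "dist (y k) x < e" if k: "k \<ge> N" and d: "dist (y k) x < 2 * e" for k
    proof -
      obtain z where z: "z \<in> Z" "dist (y k) z < e" using N(1)[OF k] by blast
      have "dist x z \<le> dist (y k) x + dist (y k) z" by (metis dist_commute dist_triangle)
      then have "z = x" using r(2)[OF z(1)] z d e by linarith
      then show ?thesis using z by simp
    qed
    obtain k0 where "\<And>k. k \<ge> k0 \<Longrightarrow> dist (y (f k)) x < 2 * e"
      using tendstoD[OF f(2), of "2 * e"] e unfolding eventually_sequentially by auto
    then have "dist (y (f (max k0 N))) x < 2 * e" by simp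
    moreover have "f (max k0 N) \<ge> N"
      using seq_suble[OF f(1), of "max k0 N"] by simp
    ultimately obtain k1 where k1: "k1 \<ge> N" "dist (y k1) x < 2 * e" by blast
    have "dist (y k) x < e" if "k \<ge> k1" for k
      using that
    proof (induction k rule: dec_induct)
      case base
      show ?case using pull k1 by blast
    next
      case (step k)
      have "dist (y (Suc k)) x \<le> dist (y (Suc k)) (y k) + dist (y k) x" by (rule dist_triangle)
      then show ?case using N(2)[of k] step k1 by (intro pull) auto
    qed
    then show "\<forall>\<^sub>F k in sequentially. dist (y k) x < e0"
      using e(2) unfolding eventually_sequentially by (intro exI[of _ k1]) force
  qed
  with x show ?thesis by blast
qed

section \<open>Supermartingales driven by i.i.d. noise\<close>

locale iid_noise = prob_space M for M :: "'w measure" +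
  fixes S :: "'s measure" and \<xi> :: "'w \<Rightarrow> 's" and \<xi>s :: "nat \<Rightarrow> 'w \<Rightarrow> 's"
  assumes indep: "indep_vars (\<lambda>_. S) \<xi>s UNIV"
    and generic[measurable]: "\<xi> \<in> measurable M S"
    and identical: "\<And>k. distr M S (\<xi>s k) = distr M S \<xi>"
begin

lemma noise_measurable[measurable]: "\<xi>s k \<in> measurable M S"
  using indep unfolding indep_vars_def by auto

text \<open>The sigma-algebra of the samples with index below k: the k-th iterate is measurable for
  it, while \<open>\<xi>s k\<close> is still fresh. As a pullback of the product sigma-algebra it
  fits independence of disjoint blocks of samples.\<close>

definition hist :: "nat \<Rightarrow> 'w measure" where
  "hist k = vimage_algebra (space M) (\<lambda>\<omega>. restrict (\<lambda>i. \<xi>s i \<omega>) {..<k}) (PiM {..<k} (\<lambda>_. S))"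

lemma space_hist[simp]: "space (hist k) = space M"
  by (simp add: hist_def)

text \<open>Minimality of the pullback, stated for an arbitrary N so that N = M and N a later
  history are both instances.\<close>

lemma hist_leI:
  assumes "(\<lambda>\<omega>. restrict (\<lambda>i. \<xi>s i \<omega>) {..<k}) \<in> measurable N (PiM {..<k} (\<lambda>_. S))"
    and "space N = space M" and "f \<in> measurable (hist k) L"
  shows "f \<in> measurable N L"
proof -
  have "(\<lambda>x. x) \<in> measurable N (hist k)"
    unfolding hist_def using assms by (intro measurable_vimage_algebra2) auto
  from measurable_compose[OF this assms(3)] show ?thesis by simp
qed

lemma restrict_noise_space:
  "\<omega> \<in> space M \<Longrightarrow> restrict (\<lambda>i. \<xi>s i \<omega>) K \<in> space (PiM K (\<lambda>_. S))"
  by (rule measurable_space[of "\<lambda>\<omega>. restrict (\<lambda>i. \<xi>s i \<omega>) K" M]) measurable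

lemma noise_hist: "\<xi>s i \<in> measurable (hist k) S" if "i < k"
proof -
  have "(\<lambda>\<omega>. restrict (\<lambda>i. \<xi>s i \<omega>) {..<k}) \<in> measurable (hist k) (PiM {..<k} (\<lambda>_. S))"
    unfolding hist_def by (intro measurable_vimage_algebra1 funcsetI restrict_noise_space)
  from measurable_compose[OF this measurable_component_singleton[of i]] that
  show ?thesis by simp
qed

lemma hist_measurable: "f \<in> measurable (hist k) N \<Longrightarrow> f \<in> measurable M N"
  by (rule hist_leI[where k = k]) auto

lemma hist_mono: "f \<in> measurable (hist k) N" if "f \<in> measurable (hist j) N" "j \<le> k"
proof (rule hist_leI[OF _ _ that(1)])
  show "(\<lambda>\<omega>. restrict (\<lambda>i. \<xi>s i \<omega>) {..<j}) \<in> measurable (hist k) (PiM {..<j} (\<lambda>_. S))"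
    using that(2) by (intro measurable_restrict noise_hist) auto
qed simp

lemma sets_hist_mono: "A \<in> sets (hist k)" if "A \<in> sets (hist j)" "j \<le> k"
proof -
  have "(\<lambda>x. x) \<in> measurable (hist k) (hist j)"
    by (rule hist_mono[OF _ that(2)]) simp
  from measurable_sets[OF this that(1)] sets.sets_into_space[OF that(1)]
  show ?thesis by (simp add: Int_absorb2)
qed

lemma sets_hist_sub: "A \<in> sets M" if "A \<in> sets (hist k)"
proof -
  have "(\<lambda>x. x) \<in> measurable M (hist k)"
    by (rule hist_measurable[of _ k]) auto
  from measurable_sets[OF this that(1)] sets.sets_into_space[OF that(1)]
  show ?thesis by (simp add: Int_absorb2)
qed

text \<open>
  \<^const>\<open>indep_var\<close> requires both variables to have the same type, hence this formulation through the
  joint law.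
\<close>

lemma distr_hist_noise:
  assumes Y: "Y \<in> measurable (hist k) N"
  shows "distr M N Y \<Otimes>\<^sub>M distr M S \<xi> = distr M (N \<Otimes>\<^sub>M S) (\<lambda>\<omega>. (Y \<omega>, \<xi>s k \<omega>))"
proof -
  note [measurable] = hist_measurable[OF Y]
  interpret DY: prob_space "distr M N Y" by (rule prob_space_distr) simp
  interpret DX: prob_space "distr M S \<xi>" by (rule prob_space_distr) simp
  let ?H = "\<lambda>K \<omega>. restrict (\<lambda>i. \<xi>s i \<omega>) K"
  \<comment> \<open>Past and present are packed as functions on index sets and so share a type. Only
    the independence of the two generated sigma-algebras is kept; they contain the events of Y and
    of \<open>\<xi>s k\<close>.\<close>
  have "indep_var (PiM {..<k} (\<lambda>_. S)) (?H {..<k}) (PiM {k} (\<lambda>_. S)) (?H {k})"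
    by (rule indep_var_restrict[OF indep]) auto
  then have ind: "indep_set (sigma_sets (space M) {?H {..<k} -` A \<inter> space M | A. A \<in> sets (PiM {..<k} (\<lambda>_. S))})
      (sigma_sets (space M) {?H {k} -` A \<inter> space M | A. A \<in> sets (PiM {k} (\<lambda>_. S))})"
    by (simp add: indep_var_eq)
  show ?thesis
  proof (rule pair_measure_eqI)
    fix A B assume "A \<in> sets (distr M N Y)" "B \<in> sets (distr M S \<xi>)"
    then have A[measurable]: "A \<in> sets N" and B[measurable]: "B \<in> sets S" by auto
    have "Y -` A \<inter> space M \<in> sets (hist k)" using measurable_sets[OF Y A] by simp
    then have a: "Y -` A \<inter> space M
        \<in> sigma_sets (space M) {?H {..<k} -` A \<inter> space M | A. A \<in> sets (PiM {..<k} (\<lambda>_. S))}"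
      by (simp add: hist_def sets_vimage_algebra)
    have "(\<lambda>f. f k) -` B \<inter> space (PiM {k} (\<lambda>_. S)) \<in> sets (PiM {k} (\<lambda>_. S))"
      by measurable
    moreover have "\<xi>s k -` B \<inter> space M
        = ?H {k} -` ((\<lambda>f. f k) -` B \<inter> space (PiM {k} (\<lambda>_. S))) \<inter> space M"
      using restrict_noise_space[of _ "{k}"] by auto
    ultimately have b: "\<xi>s k -` B \<inter> space M
        \<in> sigma_sets (space M) {?H {k} -` A \<inter> space M | A. A \<in> sets (PiM {k} (\<lambda>_. S))}"
      by (intro sigma_sets.Basic) blast
    have "emeasure (distr M N Y) A * emeasure (distr M S \<xi>) B
        = emeasure (distr M N Y) A * emeasure (distr M S (\<xi>s k)) B"
      by (simp add: identical)
    also have "\<dots> = ennreal (prob (Y -` A \<inter> space M) * prob (\<xi>s k -` B \<inter> space M))"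
      by (simp add: emeasure_distr emeasure_eq_measure ennreal_mult)
    also have "\<dots> = emeasure M ((Y -` A \<inter> space M) \<inter> (\<xi>s k -` B \<inter> space M))"
      by (simp add: indep_setD[OF ind a b] emeasure_eq_measure)
    also have "\<dots> = emeasure (distr M (N \<Otimes>\<^sub>M S) (\<lambda>\<omega>. (Y \<omega>, \<xi>s k \<omega>))) (A \<times> B)"
      by (subst emeasure_distr) (auto intro!: arg_cong[where f = "emeasure M"])
    finally show "emeasure (distr M N Y) A * emeasure (distr M S \<xi>) B
        = emeasure (distr M (N \<Otimes>\<^sub>M S) (\<lambda>\<omega>. (Y \<omega>, \<xi>s k \<omega>))) (A \<times> B)" .
  qed (auto intro: DY.sigma_finite_measure_axioms DX.sigma_finite_measure_axioms cong: sets_pair_measure_cong)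
qed

text \<open>The substitute for conditional expectation: the past Y is frozen, and the fresh sample
  is integrated out as an independent copy with the law of \<xi>. For nonnegative h, Tonelli asks
  for no integrability.\<close>

lemma nn_integral_freeze:
  assumes Y: "Y \<in> measurable (hist k) N" and h: "h \<in> borel_measurable (N \<Otimes>\<^sub>M S)"
  shows "(\<integral>\<^sup>+\<omega>. h (Y \<omega>, \<xi>s k \<omega>) \<partial>M) = (\<integral>\<^sup>+\<omega>. (\<integral>\<^sup>+\<omega>'. h (Y \<omega>, \<xi> \<omega>') \<partial>M) \<partial>M)"
proof -
  note [measurable] = hist_measurable[OF Y] h
  interpret D: prob_space "distr M S \<xi>" by (rule prob_space_distr) simp
  have "(\<integral>\<^sup>+\<omega>. h (Y \<omega>, \<xi>s k \<omega>) \<partial>M) = (\<integral>\<^sup>+z. h z \<partial>distr M (N \<Otimes>\<^sub>M S) (\<lambda>x. (Y x, \<xi>s k x)))"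
    by (subst nn_integral_distr) auto
  also have "\<dots> = (\<integral>\<^sup>+z. h z \<partial>(distr M N Y \<Otimes>\<^sub>M distr M S \<xi>))" by (simp only: distr_hist_noise[OF Y])
  also have "\<dots> = (\<integral>\<^sup>+x. (\<integral>\<^sup>+s. h (x, s) \<partial>distr M S \<xi>) \<partial>distr M N Y)"
    by (subst D.nn_integral_fst[symmetric]) auto
  also have "\<dots> = (\<integral>\<^sup>+\<omega>. (\<integral>\<^sup>+s. h (Y \<omega>, s) \<partial>distr M S \<xi>) \<partial>M)"
    by (subst nn_integral_distr) (auto intro!: D.borel_measurable_nn_integral)
  also have "\<dots> = (\<integral>\<^sup>+\<omega>. (\<integral>\<^sup>+\<omega>'. h (Y \<omega>, \<xi> \<omega>') \<partial>M) \<partial>M)"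
    using hist_measurable[OF Y] by (intro nn_integral_cong) (subst nn_integral_distr, auto dest: measurable_space)
  finally show ?thesis .
qed

text \<open>The conditional inequality is tested on events of the past. With \<open>ennreal\<close>
  values the start \<open>U K\<close> may have infinite mean.\<close>

definition supermart :: "nat \<Rightarrow> (nat \<Rightarrow> 'w \<Rightarrow> ennreal) \<Rightarrow> bool" where
  "supermart K U \<longleftrightarrow> (\<forall>n\<ge>K. U n \<in> borel_measurable (hist n) \<and>
     (\<forall>A\<in>sets (hist n). (\<integral>\<^sup>+\<omega>. U (Suc n) \<omega> * indicator A \<omega> \<partial>M) \<le> (\<integral>\<^sup>+\<omega>. U n \<omega> * indicator A \<omega> \<partial>M)))"

text \<open>\<open>Y n\<close> is the state reached so far and \<open>h n\<close> the next value as
  a function of state and sample; the supermartingale inequality reduces to a pointwise one with the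
  state fixed.\<close>

lemma supermartI:
  fixes h :: "nat \<Rightarrow> 'n \<times> 's \<Rightarrow> ennreal"
  assumes meas: "\<And>n. K \<le> n \<Longrightarrow> U n \<in> borel_measurable (hist n)"
    and Y: "\<And>n. K \<le> n \<Longrightarrow> Y n \<in> measurable (hist n) N"
    and h: "\<And>n. K \<le> n \<Longrightarrow> h n \<in> borel_measurable (N \<Otimes>\<^sub>M S)"
    and step: "\<And>n \<omega>. K \<le> n \<Longrightarrow> \<omega> \<in> space M \<Longrightarrow> U (Suc n) \<omega> = h n (Y n \<omega>, \<xi>s n \<omega>)"
    and le: "\<And>n \<omega>. K \<le> n \<Longrightarrow> \<omega> \<in> space M \<Longrightarrow> (\<integral>\<^sup>+\<omega>'. h n (Y n \<omega>, \<xi> \<omega>') \<partial>M) \<le> U n \<omega>"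
  shows "supermart K U"
  unfolding supermart_def
proof (intro allI impI conjI ballI)
  fix n A assume n: "K \<le> n" and A: "A \<in> sets (hist n)"
  note Yn[measurable] = Y[OF n] and hn[measurable] = h[OF n]
  \<comment> \<open>The indicator of the past event joins the state, so that
    \<open>nn_integral_freeze\<close> covers the integral over A.\<close>
  have YA: "(\<lambda>\<omega>. (Y n \<omega>, indicator A \<omega> :: ennreal)) \<in> measurable (hist n) (N \<Otimes>\<^sub>M borel)"
    using A by measurable
  have hA: "(\<lambda>z. h n (fst (fst z), snd z) * snd (fst z)) \<in> borel_measurable ((N \<Otimes>\<^sub>M borel) \<Otimes>\<^sub>M S)"
    by measurable
  have "(\<integral>\<^sup>+\<omega>. U (Suc n) \<omega> * indicator A \<omega> \<partial>M) = (\<integral>\<^sup>+\<omega>. h n (Y n \<omega>, \<xi>s n \<omega>) * indicator A \<omega> \<partial>M)"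
    using step[OF n] by (intro nn_integral_cong) auto
  also have "\<dots> = (\<integral>\<^sup>+\<omega>. (\<integral>\<^sup>+\<omega>'. h n (Y n \<omega>, \<xi> \<omega>') * indicator A \<omega> \<partial>M) \<partial>M)"
    using nn_integral_freeze[OF YA hA] by simp
  also have "\<dots> = (\<integral>\<^sup>+\<omega>. (\<integral>\<^sup>+\<omega>'. h n (Y n \<omega>, \<xi> \<omega>') \<partial>M) * indicator A \<omega> \<partial>M)"
  proof (intro nn_integral_cong nn_integral_multc)
    fix \<omega> assume "\<omega> \<in> space M"
    then have [measurable]: "Y n \<omega> \<in> space N" using measurable_space[OF Yn] by simp
    show "(\<lambda>\<omega>'. h n (Y n \<omega>, \<xi> \<omega>')) \<in> borel_measurable M" by measurable
  qed
  also have "\<dots> \<le> (\<integral>\<^sup>+\<omega>. U n \<omega> * indicator A \<omega> \<partial>M)"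
    using le[OF n] by (intro nn_integral_mono mult_right_mono) auto
  finally show "(\<integral>\<^sup>+\<omega>. U (Suc n) \<omega> * indicator A \<omega> \<partial>M) \<le> (\<integral>\<^sup>+\<omega>. U n \<omega> * indicator A \<omega> \<partial>M)" .
qed (use meas in auto)

text \<open>Doob's maximal inequality without stopping times. \<open>E n\<close> holds the paths of
  A still below c up to time n, and the mean of the process stopped on reaching c and capped there
  never increases.\<close>

lemma supermart_maximal:
  assumes sm: "supermart K U" and A: "A \<in> sets (hist K)"
  shows "c * emeasure M {\<omega>\<in>A. \<exists>n\<ge>K. c \<le> U n \<omega>} \<le> (\<integral>\<^sup>+\<omega>. U K \<omega> * indicator A \<omega> \<partial>M)"
proof -
  have Um: "U n \<in> borel_measurable (hist n)" if "K \<le> n" for n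
    using sm that by (simp add: supermart_def)
  have UM: "U n \<in> borel_measurable M" if "K \<le> n" for n
    using hist_measurable Um that by blast
  define E where "E n = {\<omega>\<in>A. \<forall>j\<in>{K..n}. U j \<omega> < c}" for n
  have Asub: "A \<subseteq> space M" using sets.sets_into_space[OF A] by simp
  have E: "E n \<in> sets (hist n)" if "K \<le> n" for n
  proof -
    have [measurable]: "U j \<in> borel_measurable (hist n)" if "j \<in> {K..n}" for j
      using that hist_mono[OF Um] by simp
    have [measurable]: "A \<in> sets (hist n)" using sets_hist_mono[OF A that] .
    have "{\<omega>\<in>space (hist n). \<omega> \<in> A \<and> (\<forall>j\<in>{K..n}. U j \<omega> < c)} \<in> sets (hist n)"
      by measurable
    also have "{\<omega>\<in>space (hist n). \<omega> \<in> A \<and> (\<forall>j\<in>{K..n}. U j \<omega> < c)} = E n"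
      using Asub by (auto simp: E_def)
    finally show ?thesis .
  qed
  have EM[measurable]: "E n \<in> sets M" if "K \<le> n" for n using sets_hist_sub E that by blast
  have AM[measurable]: "A \<in> sets M" using sets_hist_sub A by blast
  let ?I = "\<lambda>n. (\<integral>\<^sup>+\<omega>. c * indicator (A - E n) \<omega> + U n \<omega> * indicator (E n) \<omega> \<partial>M)"
  have I: "?I n = c * emeasure M (A - E n) + (\<integral>\<^sup>+\<omega>. U n \<omega> * indicator (E n) \<omega> \<partial>M)" if "K \<le> n" for n
    using EM[OF that] UM[OF that] by (subst nn_integral_add) (auto simp: nn_integral_cmult_indicator)
  have bound: "?I n \<le> (\<integral>\<^sup>+\<omega>. U K \<omega> * indicator A \<omega> \<partial>M)" if "K \<le> n" for n
    using that
  proof (induction n rule: dec_induct)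
    case base
    show ?case
      by (intro nn_integral_mono) (auto simp: E_def indicator_def)
  next
    case (step n)
    \<comment> \<open>A path that leaves \<open>E n\<close> at time n + 1 has value at least c
      there, so capping it only lowers the integrand.\<close>
    have "?I (Suc n) \<le> (\<integral>\<^sup>+\<omega>. c * indicator (A - E n) \<omega> + U (Suc n) \<omega> * indicator (E n) \<omega> \<partial>M)"
      using step by (intro nn_integral_mono) (auto simp: E_def indicator_def le_Suc_eq)
    also have "\<dots> = c * emeasure M (A - E n) + (\<integral>\<^sup>+\<omega>. U (Suc n) \<omega> * indicator (E n) \<omega> \<partial>M)"
      using EM[of n] UM[of "Suc n"] step by (subst nn_integral_add) (auto simp: nn_integral_cmult_indicator)
    also have "\<dots> \<le> ?I n"
      using sm E[of n] step by (subst I) (auto simp: supermart_def intro!: add_left_mono)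
    finally show ?case using step by (meson order_trans)
  qed
  have "{\<omega>\<in>A. \<exists>n\<ge>K. c \<le> U n \<omega>} = (\<Union>n. A - E (K + n))"
  proof (intro set_eqI iffI)
    fix \<omega> assume "\<omega> \<in> {\<omega>\<in>A. \<exists>n\<ge>K. c \<le> U n \<omega>}"
    then obtain n where "\<omega> \<in> A" "K \<le> n" "c \<le> U n \<omega>" by auto
    then have "\<omega> \<in> A - E (K + (n - K))" by (auto simp: E_def not_less)
    then show "\<omega> \<in> (\<Union>n. A - E (K + n))" by blast
  qed (auto simp: E_def not_less)
  also have "emeasure M \<dots> = (SUP n. emeasure M (A - E (K + n)))"
  proof (rule SUP_emeasure_incseq[symmetric])
    show "incseq (\<lambda>n. A - E (K + n))" by (auto simp: incseq_def E_def)
    show "range (\<lambda>n. A - E (K + n)) \<subseteq> sets M" using EM AM by auto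
  qed
  also have "c * \<dots> = (SUP n. c * emeasure M (A - E (K + n)))"
    by (rule SUP_mult_left_ennreal)
  also have "\<dots> \<le> (\<integral>\<^sup>+\<omega>. U K \<omega> * indicator A \<omega> \<partial>M)"
  proof (rule SUP_least)
    fix n
    have "c * emeasure M (A - E (K + n)) \<le> ?I (K + n)" by (subst I) auto
    also have "\<dots> \<le> (\<integral>\<^sup>+\<omega>. U K \<omega> * indicator A \<omega> \<partial>M)" by (rule bound) simp
    finally show "c * emeasure M (A - E (K + n)) \<le> (\<integral>\<^sup>+\<omega>. U K \<omega> * indicator A \<omega> \<partial>M)" .
  qed
  finally show ?thesis .
qed

text \<open>Where the start is at most i, the maximal inequality bounds the probability of reaching
  j by i/j, which vanishes as j grows; countably many i exhaust the space since the start is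
  finite.\<close>

lemma supermart_AE_bounded:
  assumes sm: "supermart K U" and fin: "\<And>\<omega>. \<omega> \<in> space M \<Longrightarrow> U K \<omega> < \<infinity>"
  shows "AE \<omega> in M. \<exists>j::nat. \<forall>n\<ge>K. U n \<omega> \<le> of_nat j"
proof -
  have Um: "U n \<in> borel_measurable (hist n)" if "K \<le> n" for n
    using sm that by (simp add: supermart_def)
  have UM: "U n \<in> borel_measurable M" if "K \<le> n" for n
    using hist_measurable Um that by blast
  have UK[measurable]: "U K \<in> borel_measurable (hist K)" "U K \<in> borel_measurable M" using Um UM by auto
  define A where "A i = {\<omega>\<in>space M. U K \<omega> \<le> of_nat i}" for i :: nat
  have A: "A i \<in> sets (hist K)" for i
  proof -
    have "{\<omega>\<in>space (hist K). U K \<omega> \<le> of_nat i} \<in> sets (hist K)" by measurable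
    then show ?thesis by (simp add: A_def)
  qed
  define B where "B i j = {\<omega>\<in>A i. \<exists>n\<ge>K. of_nat j \<le> U n \<omega>}" for i j :: nat
  have B: "B i j \<in> sets M" for i j
  proof -
    have [measurable]: "A i \<in> sets M" using sets_hist_sub[OF A] .
    have [measurable]: "U n \<in> borel_measurable M" if "n \<in> {K..}" for n using UM that by simp
    have "{\<omega>\<in>space M. \<omega> \<in> A i \<and> (\<exists>n\<in>{K..}. of_nat j \<le> U n \<omega>)} \<in> sets M" by measurable
    also have "{\<omega>\<in>space M. \<omega> \<in> A i \<and> (\<exists>n\<in>{K..}. of_nat j \<le> U n \<omega>)} = B i j"
      by (auto simp: B_def A_def)
    finally show ?thesis .
  qed
  have small: "real j * prob (B i j) \<le> real i" for i j
  proof -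
    have "of_nat j * emeasure M (B i j) \<le> (\<integral>\<^sup>+\<omega>. U K \<omega> * indicator (A i) \<omega> \<partial>M)"
      unfolding B_def by (rule supermart_maximal[OF sm A])
    also have "\<dots> \<le> (\<integral>\<^sup>+\<omega>. of_nat i \<partial>M)"
      by (intro nn_integral_mono) (auto simp: A_def indicator_def)
    also have "\<dots> = of_nat i" by (simp add: emeasure_space_1)
    finally have "ennreal (real j * prob (B i j)) \<le> ennreal (real i)"
      by (simp add: emeasure_eq_measure ennreal_of_nat_eq_real_of_nat ennreal_mult)
    then show ?thesis by simp
  qed
  have null: "(\<Inter>j. B i j) \<in> null_sets M" for i
  proof -
    have m: "(\<Inter>j. B i j) \<in> sets M" using B by auto
    have "prob (\<Inter>j. B i j) = 0"
    proof (rule ccontr)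
      assume "prob (\<Inter>j. B i j) \<noteq> 0"
      then have "0 < prob (\<Inter>j. B i j)" by (simp add: zero_less_measure_iff)
      then obtain j where "real i < real j * prob (\<Inter>j. B i j)"
        using reals_Archimedean3 by blast
      also have "\<dots> \<le> real j * prob (B i j)"
        using B by (intro mult_left_mono finite_measure_mono) auto
      finally show False using small[of j i] by simp
    qed
    then show ?thesis using m by (simp add: null_sets_def emeasure_eq_measure)
  qed
  have "AE \<omega> in M. \<omega> \<notin> (\<Inter>j. B i j)" for i by (rule AE_not_in[OF null])
  then have "AE \<omega> in M. \<forall>i. \<omega> \<notin> (\<Inter>j. B i j)" by (simp only: AE_all_countable) simp
  then show ?thesis using AE_space
  proof eventually_elim
    case (elim \<omega>)
    obtain i :: nat where "U K \<omega> < of_nat i"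
      using fin[OF elim(2)] ennreal_Ex_less_of_nat by auto
    then have "\<omega> \<in> A i" using elim(2) by (simp add: A_def)
    moreover obtain j where "\<omega> \<notin> B i j" using elim(1) by blast
    ultimately have "\<forall>n\<ge>K. \<not> of_nat j \<le> U n \<omega>" by (auto simp: B_def)
    then have "\<forall>n\<ge>K. U n \<omega> \<le> of_nat j" using linear by blast
    then show ?case ..
  qed
qed


text \<open>Kolmogorov's argument. The centred increments are orthogonal to the past, so the squared
  norm of the partial sum from m gains at most v n in mean; the maximal inequality started at m,
  where that sum is 0, bounds the later oscillation by the tail of the variances.\<close>

lemma noise_sum_Cauchy:
  fixes D :: "nat \<Rightarrow> 'n \<times> 's \<Rightarrow> 'a::euclidean_space"
  assumes Y: "\<And>n. Y n \<in> measurable (hist n) N"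
    and D: "\<And>n. D n \<in> borel_measurable (N \<Otimes>\<^sub>M S)"
    and mean: "\<And>n \<omega>. \<omega> \<in> space M \<Longrightarrow> has_bochner_integral M (\<lambda>\<omega>'. D n (Y n \<omega>, \<xi> \<omega>')) 0"
    and var: "\<And>n \<omega>. \<omega> \<in> space M \<Longrightarrow> (\<integral>\<^sup>+\<omega>'. ennreal ((norm (D n (Y n \<omega>, \<xi> \<omega>')))\<^sup>2) \<partial>M) \<le> ennreal (v n)"
    and v: "summable v" "\<And>n. 0 \<le> v n"
  shows "AE \<omega> in M. Cauchy (\<lambda>n. \<Sum>k<n. D k (Y k \<omega>, \<xi>s k \<omega>))"
proof -
  note [measurable] = D hist_measurable[OF Y]
  have [measurable]: "Y k \<in> measurable (hist n) N" if "k \<le> n" for k n using hist_mono[OF Y that] .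
  have [measurable]: "\<xi>s k \<in> measurable (hist n) S" if "k < n" for k n using noise_hist[OF that] .
  define X where "X m n \<omega> = (\<Sum>k=m..<n. D k (Y k \<omega>, \<xi>s k \<omega>))" for m n \<omega>
  have X[measurable]: "X m n \<in> borel_measurable (hist n)" for m n
    unfolding X_def by (intro borel_measurable_sum) (auto intro!: measurable_compose[OF _ D] measurable_Pair)
  have XM[measurable]: "X m n \<in> borel_measurable M" for m n by (rule hist_measurable[OF X])
  \<comment> \<open>The variance still to come: adding it turns the growing squared norm into a
    supermartingale.\<close>
  define t where "t n = (\<Sum>k. v (k + n))" for n
  have t: "t n = v n + t (Suc n)" "0 \<le> t n" for n
  proof -
    have s: "summable (\<lambda>k. v (k + n))" using v(1) by (simp add: summable_iff_shift)
    show "t n = v n + t (Suc n)" using suminf_split_head[OF s] by (simp add: t_def)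
    show "0 \<le> t n" unfolding t_def by (rule suminf_nonneg[OF s v(2)])
  qed
  have t0: "t \<longlonglongrightarrow> 0" unfolding t_def by (rule suminf_exist_split2[OF v(1)])
  have sm: "supermart m (\<lambda>n \<omega>. ennreal ((norm (X m n \<omega>))\<^sup>2 + t n))" for m
  proof (rule supermartI)
    show "(\<lambda>\<omega>. ennreal ((norm (X m n \<omega>))\<^sup>2 + t n)) \<in> borel_measurable (hist n)" for n
      by measurable
    \<comment> \<open>The partial sum belongs to the state, since the next squared norm depends on
      it.\<close>
    show "(\<lambda>\<omega>. (Y n \<omega>, X m n \<omega>)) \<in> measurable (hist n) (N \<Otimes>\<^sub>M borel)" for n
      using Y[of n] by measurable
    show "(\<lambda>z. ennreal ((norm (snd (fst z) + D n (fst (fst z), snd z)))\<^sup>2 + t (Suc n)))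
        \<in> borel_measurable ((N \<Otimes>\<^sub>M borel) \<Otimes>\<^sub>M S)" for n
      by measurable
    show "ennreal ((norm (X m (Suc n) \<omega>))\<^sup>2 + t (Suc n))
      = ennreal ((norm (snd (fst ((Y n \<omega>, X m n \<omega>), \<xi>s n \<omega>))
          + D n (fst (fst ((Y n \<omega>, X m n \<omega>), \<xi>s n \<omega>)), snd ((Y n \<omega>, X m n \<omega>), \<xi>s n \<omega>))))\<^sup>2 + t (Suc n))"
      if "m \<le> n" for n \<omega> using that by (simp add: X_def)
    fix n \<omega> assume \<omega>: "\<omega> \<in> space M"
    define d where "d \<omega>' = D n (Y n \<omega>, \<xi> \<omega>')" for \<omega>'
    define x where "x = X m n \<omega>"
    have [measurable]: "Y n \<omega> \<in> space N" using measurable_space[OF Y[of n]] \<omega> by simp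
    have [measurable]: "d \<in> borel_measurable M" unfolding d_def by measurable
    have d: "integrable M d" "(\<integral>\<omega>'. d \<omega>' \<partial>M) = 0"
      using mean[OF \<omega>, of n] by (auto simp: d_def[abs_def] has_bochner_integral_iff)
    have "(\<integral>\<^sup>+\<omega>'. ennreal ((norm (d \<omega>'))\<^sup>2) \<partial>M) \<le> ennreal (v n)" using var[OF \<omega>, of n] by (simp add: d_def)
    then have d2: "integrable M (\<lambda>\<omega>'. (norm (d \<omega>'))\<^sup>2)" "(\<integral>\<omega>'. (norm (d \<omega>'))\<^sup>2 \<partial>M) \<le> v n"
    proof -
      assume *: "(\<integral>\<^sup>+\<omega>'. ennreal ((norm (d \<omega>'))\<^sup>2) \<partial>M) \<le> ennreal (v n)"
      then show i: "integrable M (\<lambda>\<omega>'. (norm (d \<omega>'))\<^sup>2)"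
        by (intro integrableI_bounded) (auto intro: le_less_trans)
      show "(\<integral>\<omega>'. (norm (d \<omega>'))\<^sup>2 \<partial>M) \<le> v n"
        using * v(2)[of n] by (subst (asm) nn_integral_eq_integral[OF i]) auto
    qed
    have expand: "(norm (x + d \<omega>'))\<^sup>2 + t (Suc n) = (norm x)\<^sup>2 + 2 * inner x (d \<omega>') + (norm (d \<omega>'))\<^sup>2 + t (Suc n)" for \<omega>'
      by (simp add: power2_norm_eq_inner inner_add_left inner_add_right inner_commute)
    have int: "integrable M (\<lambda>\<omega>'. (norm (x + d \<omega>'))\<^sup>2 + t (Suc n))"
      unfolding expand using d d2 by auto
    have "(\<integral>\<omega>'. (norm (x + d \<omega>'))\<^sup>2 + t (Suc n) \<partial>M) = (norm x)\<^sup>2 + (\<integral>\<omega>'. (norm (d \<omega>'))\<^sup>2 \<partial>M) + t (Suc n)"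
      unfolding expand using d d2 by (simp add: prob_space)
    also have "\<dots> \<le> (norm x)\<^sup>2 + t n" using d2 t(1)[of n] by simp
    finally have "ennreal (\<integral>\<omega>'. (norm (x + d \<omega>'))\<^sup>2 + t (Suc n) \<partial>M) \<le> ennreal ((norm x)\<^sup>2 + t n)"
      by (rule ennreal_leI)
    then show "(\<integral>\<^sup>+\<omega>'. ennreal ((norm (snd (fst ((Y n \<omega>, X m n \<omega>), \<xi> \<omega>'))
          + D n (fst (fst ((Y n \<omega>, X m n \<omega>), \<xi> \<omega>')), snd ((Y n \<omega>, X m n \<omega>), \<xi> \<omega>'))))\<^sup>2 + t (Suc n)) \<partial>M)
        \<le> ennreal ((norm (X m n \<omega>))\<^sup>2 + t n)"
      using t(2) int by (subst nn_integral_eq_integral) (auto simp: d_def x_def)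
  qed
  have small: "e\<^sup>2 * prob {\<omega>\<in>space M. \<exists>n\<ge>m. e \<le> norm (X m n \<omega>)} \<le> t m" if e: "0 < e" for e m
  proof -
    have "ennreal (e\<^sup>2) * emeasure M {\<omega>\<in>space M. \<exists>n\<ge>m. e \<le> norm (X m n \<omega>)}
      \<le> ennreal (e\<^sup>2) * emeasure M {\<omega>\<in>space M. \<exists>n\<ge>m. ennreal (e\<^sup>2) \<le> ennreal ((norm (X m n \<omega>))\<^sup>2 + t n)}"
    proof (intro mult_left_mono emeasure_mono)
      show "{\<omega>\<in>space M. \<exists>n\<ge>m. e \<le> norm (X m n \<omega>)}
        \<subseteq> {\<omega>\<in>space M. \<exists>n\<ge>m. ennreal (e\<^sup>2) \<le> ennreal ((norm (X m n \<omega>))\<^sup>2 + t n)}"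
        using e t(2) by (fastforce intro!: ennreal_leI add_increasing2 power_mono)
      have "{\<omega>\<in>space M. \<exists>n\<in>{m..}. ennreal (e\<^sup>2) \<le> ennreal ((norm (X m n \<omega>))\<^sup>2 + t n)} \<in> sets M"
        by measurable
      then show "{\<omega>\<in>space M. \<exists>n\<ge>m. ennreal (e\<^sup>2) \<le> ennreal ((norm (X m n \<omega>))\<^sup>2 + t n)} \<in> sets M"
        by (simp add: Bex_def)
    qed auto
    also have "\<dots> \<le> (\<integral>\<^sup>+\<omega>. ennreal ((norm (X m m \<omega>))\<^sup>2 + t m) * indicator (space M) \<omega> \<partial>M)"
      using supermart_maximal[OF sm, of "space M" m] sets.top[of "hist m"] by simp
    also have "\<dots> = (\<integral>\<^sup>+\<omega>. ennreal (t m) \<partial>M)"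
      by (intro nn_integral_cong) (auto simp: X_def)
    also have "\<dots> = ennreal (t m)" by (simp add: emeasure_space_1)
    finally show ?thesis using t(2)[of m] by (simp add: emeasure_eq_measure ennreal_mult[symmetric])
  qed
  define Bad where "Bad e = {\<omega>\<in>space M. \<forall>m. \<exists>n\<in>{m..}. e \<le> norm (X m n \<omega>)}" for e :: real
  have null: "Bad e \<in> null_sets M" if e: "0 < e" for e
  proof -
    have m: "Bad e \<in> sets M" unfolding Bad_def by measurable
    have "e\<^sup>2 * prob (Bad e) \<le> t m" for m
    proof -
      have "{\<omega>\<in>space M. \<exists>n\<in>{m..}. e \<le> norm (X m n \<omega>)} \<in> sets M" by measurable
      then have "prob (Bad e) \<le> prob {\<omega>\<in>space M. \<exists>n\<ge>m. e \<le> norm (X m n \<omega>)}"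
        by (intro finite_measure_mono) (auto simp: Bad_def Bex_def)
      then have "e\<^sup>2 * prob (Bad e) \<le> e\<^sup>2 * prob {\<omega>\<in>space M. \<exists>n\<ge>m. e \<le> norm (X m n \<omega>)}"
        by (intro mult_left_mono) auto
      then show ?thesis using small[OF e, of m] by linarith
    qed
    \<comment> \<open>\<open>Bad e\<close> does not depend on m, so m may tend to infinity in the
      tail bound.\<close>
    then have "e\<^sup>2 * prob (Bad e) \<le> 0"
      by (intro tendsto_lowerbound[OF t0]) auto
    then have "prob (Bad e) = 0" using e measure_nonneg[of M "Bad e"] by (simp add: mult_le_0_iff)
    then show ?thesis using m by (simp add: null_sets_def emeasure_eq_measure)
  qed
  then have "AE \<omega> in M. \<omega> \<notin> Bad (inverse (real (Suc i)))" for i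
    by (intro AE_not_in) auto
  then have "AE \<omega> in M. \<forall>i. \<omega> \<notin> Bad (inverse (real (Suc i)))" by (simp add: AE_all_countable)
  then show ?thesis using AE_space
  proof eventually_elim
    case (elim \<omega>)
    show ?case
    proof (rule CauchyI)
      fix e :: real assume "0 < e"
      then obtain i where i: "inverse (real (Suc i)) < e / 2" using reals_Archimedean[of "e / 2"] by auto
      have "\<omega> \<notin> Bad (inverse (real (Suc i)))" using elim(1) by blast
      with elim(2) have "\<exists>m. \<forall>n\<in>{m..}. \<not> inverse (real (Suc i)) \<le> norm (X m n \<omega>)"
        unfolding Bad_def by blast
      then obtain m where m: "\<And>n. m \<le> n \<Longrightarrow> norm (X m n \<omega>) < inverse (real (Suc i))"
        unfolding not_le by auto
      have d: "X m n \<omega> = (\<Sum>k<n. D k (Y k \<omega>, \<xi>s k \<omega>)) - (\<Sum>k<m. D k (Y k \<omega>, \<xi>s k \<omega>))" if "m \<le> n" for n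
        using sum_diff_nat_ivl[of 0 m n "\<lambda>k. D k (Y k \<omega>, \<xi>s k \<omega>)"] that
        by (simp add: X_def atLeast0LessThan)
      show "\<exists>M0. \<forall>j\<ge>M0. \<forall>n\<ge>M0. norm ((\<Sum>k<j. D k (Y k \<omega>, \<xi>s k \<omega>)) - (\<Sum>k<n. D k (Y k \<omega>, \<xi>s k \<omega>))) < e"
      proof (intro exI[of _ m] allI impI)
        fix j n assume jn: "m \<le> j" "m \<le> n"
        have "norm ((\<Sum>k<j. D k (Y k \<omega>, \<xi>s k \<omega>)) - (\<Sum>k<n. D k (Y k \<omega>, \<xi>s k \<omega>)))
            = norm (X m j \<omega> - X m n \<omega>)" using d jn by simp
        also have "\<dots> \<le> norm (X m j \<omega>) + norm (X m n \<omega>)" by (rule norm_triangle_ineq4)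
        also have "\<dots> < e" using m[OF jn(1)] m[OF jn(2)] i by simp
        finally show "norm ((\<Sum>k<j. D k (Y k \<omega>, \<xi>s k \<omega>)) - (\<Sum>k<n. D k (Y k \<omega>, \<xi>s k \<omega>))) < e" .
      qed
    qed
  qed
qed

end

section \<open>The stochastic scheme\<close>

text \<open>The assumptions from \<open>grad_F_cont\<close> on are the interface to the three
  settings. The integrand in \<open>noise_growth\<close> is the momentum displacement per unit step
  times the norms of the vectors paired with the resulting change of grad \<phi>.\<close>

locale hamiltonian_scheme = iid_noise M S \<xi> \<xi>s
  for M :: "'w measure" and S :: "'s measure" and \<xi> :: "'w \<Rightarrow> 's" and \<xi>s :: "nat \<Rightarrow> 'w \<Rightarrow> 's" +
  fixes F \<phi> :: "'a::euclidean_space \<Rightarrow> real" and g :: "'a \<Rightarrow> 's \<Rightarrow> 'a"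
    and \<alpha> :: "nat \<Rightarrow> real" and \<gamma> Fstar \<phi>star l C a0 :: real
    and p q :: "nat \<Rightarrow> 'w \<Rightarrow> 'a" and q0 :: 'a and W :: "'a \<Rightarrow> 'a \<Rightarrow> real"
  defines "W \<equiv> \<lambda>x y. 1 + (F x - Fstar) + (\<phi> y - \<phi>star)"
  assumes g_measurable: "(\<lambda>(x, s). g x s) \<in> borel_measurable (borel \<Otimes>\<^sub>M S)"
    and F_diff: "\<And>x. F differentiable (at x)"
    and \<phi>_diff: "\<And>x. \<phi> differentiable (at x)"
    and \<gamma>: "0 < \<gamma>"
    and p_0: "\<And>\<omega>. \<omega> \<in> space M \<Longrightarrow> p 0 \<omega> = 0"
    and q_0: "\<And>\<omega>. \<omega> \<in> space M \<Longrightarrow> q 0 \<omega> = q0"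
    and p_Suc: "\<And>k \<omega>. \<omega> \<in> space M \<Longrightarrow>
      p (Suc k) \<omega> = p k \<omega> - \<alpha> k *\<^sub>R g (q k \<omega>) (\<xi>s k \<omega>) - (\<alpha> k * \<gamma>) *\<^sub>R grad \<phi> (p k \<omega>)"
    and q_Suc: "\<And>k \<omega>. \<omega> \<in> space M \<Longrightarrow>
      q (Suc k) \<omega> = q k \<omega> + \<alpha> k *\<^sub>R grad \<phi> (p (Suc k) \<omega>)"
    and F_coercive: "filterlim F at_top at_infinity"
    and F_lower: "\<And>x. Fstar \<le> F x"
    and unbiased: "\<And>x. has_bochner_integral M (\<lambda>\<omega>. g x (\<xi> \<omega>)) (grad F x)"
    and l: "0 < l" and \<phi>_lip: "\<And>x y. norm (grad \<phi> y - grad \<phi> x) \<le> l * norm (x - y)"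
    and \<phi>_convex: "\<And>x y. \<phi> y - \<phi> x \<le> inner (grad \<phi> y) (y - x)"
    and \<phi>_coercive: "filterlim \<phi> at_top at_infinity"
    and \<phi>_lower: "\<And>x. \<phi>star \<le> \<phi> x"
    and \<alpha>_nonneg: "\<And>k. 0 \<le> \<alpha> k"
    and \<alpha>_sum: "filterlim (\<lambda>n. \<Sum>k<n. \<alpha> k) at_top sequentially"
    and \<alpha>_sq_sum: "summable (\<lambda>k. (\<alpha> k)\<^sup>2)"
    and grad_F_cont: "continuous_on UNIV (grad F)"
    and C: "0 \<le> C" and a0: "0 < a0"
    and descent: "\<And>a x y. 0 \<le> a \<Longrightarrow> a \<le> a0 \<Longrightarrow>
      F (x + a *\<^sub>R grad \<phi> y) \<le> F x + a * inner (grad F x) (grad \<phi> y) + C * a\<^sup>2 * W x y"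
    and noise_growth: "\<And>x y. integrable M (\<lambda>\<omega>. norm (g x (\<xi> \<omega>) + \<gamma> *\<^sub>R grad \<phi> y)
        * (norm (grad F x - g x (\<xi> \<omega>)) + \<gamma> * norm (grad \<phi> y)))"
      "\<And>x y. (\<integral>\<omega>. norm (g x (\<xi> \<omega>) + \<gamma> *\<^sub>R grad \<phi> y)
        * (norm (grad F x - g x (\<xi> \<omega>)) + \<gamma> * norm (grad \<phi> y)) \<partial>M) \<le> C * W x y"
    and local_variance: "\<And>R. \<exists>v\<ge>0. \<forall>x. norm x \<le> R \<longrightarrow>
      (\<integral>\<^sup>+\<omega>. ennreal ((norm (grad F x - g x (\<xi> \<omega>)))\<^sup>2) \<partial>M) \<le> ennreal v"
begin

section \<open>Regularity of the data and adaptedness of the iterates\<close>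

lemma W_ge_1: "1 \<le> W x y"
  using F_lower[of x] \<phi>_lower[of y] by (simp add: W_def)

lemma continuous_F: "continuous_on UNIV F"
  using F_diff by (auto intro!: continuous_at_imp_continuous_on differentiable_imp_continuous_within)

lemma continuous_\<phi>: "continuous_on UNIV \<phi>"
  using \<phi>_diff by (auto intro!: continuous_at_imp_continuous_on differentiable_imp_continuous_within)

lemma continuous_grad_\<phi>: "continuous_on UNIV (grad \<phi>)"
  by (rule L0L1_smooth_continuous_grad[OF L0L1_smooth_of_lipschitz[OF \<phi>_diff \<phi>_lip l]])

lemma borel_maps[measurable]:
  "F \<in> borel_measurable borel" "\<phi> \<in> borel_measurable borel"
  "grad F \<in> borel_measurable borel" "grad \<phi> \<in> borel_measurable borel"
  using continuous_F continuous_\<phi> continuous_grad_\<phi> grad_F_cont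
  by (auto intro: borel_measurable_continuous_onI)

lemma g_meas[measurable (raw)]:
  assumes "X \<in> borel_measurable N" "Z \<in> measurable N S"
  shows "(\<lambda>\<omega>. g (X \<omega>) (Z \<omega>)) \<in> borel_measurable N"
  using measurable_compose[OF measurable_Pair[OF assms] g_measurable] by simp

text \<open>Here x is the position and y the momentum. As a function of state and sample, the step
  can be evaluated both at \<open>\<xi>s n\<close> and at the generic \<xi>.\<close>

definition next_p :: "real \<Rightarrow> 'a \<Rightarrow> 'a \<Rightarrow> 's \<Rightarrow> 'a" where
  "next_p a x y s = y - a *\<^sub>R g x s - (a * \<gamma>) *\<^sub>R grad \<phi> y"

definition next_q :: "real \<Rightarrow> 'a \<Rightarrow> 'a \<Rightarrow> 's \<Rightarrow> 'a" where
  "next_q a x y s = x + a *\<^sub>R grad \<phi> (next_p a x y s)"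

lemma iter_measurable: "p n \<in> borel_measurable (hist n) \<and> q n \<in> borel_measurable (hist n)"
proof (induction n)
  case 0
  have "p 0 \<in> borel_measurable (hist 0) \<longleftrightarrow> (\<lambda>_. 0 :: 'a) \<in> borel_measurable (hist 0)"
    by (intro measurable_cong) (simp add: p_0)
  moreover have "q 0 \<in> borel_measurable (hist 0) \<longleftrightarrow> (\<lambda>_. q0) \<in> borel_measurable (hist 0)"
    by (intro measurable_cong) (simp add: q_0)
  ultimately show ?case by simp
next
  case (Suc n)
  have [measurable]: "p n \<in> borel_measurable (hist (Suc n))" "q n \<in> borel_measurable (hist (Suc n))"
    "\<xi>s n \<in> measurable (hist (Suc n)) S"
    using Suc by (auto intro: hist_mono[of _ n] noise_hist)
  have "p (Suc n) \<in> borel_measurable (hist (Suc n)) \<longleftrightarrow>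
      (\<lambda>\<omega>. p n \<omega> - \<alpha> n *\<^sub>R g (q n \<omega>) (\<xi>s n \<omega>) - (\<alpha> n * \<gamma>) *\<^sub>R grad \<phi> (p n \<omega>)) \<in> borel_measurable (hist (Suc n))"
    by (intro measurable_cong) (simp add: p_Suc)
  then have [measurable]: "p (Suc n) \<in> borel_measurable (hist (Suc n))" by simp
  have "q (Suc n) \<in> borel_measurable (hist (Suc n)) \<longleftrightarrow>
      (\<lambda>\<omega>. q n \<omega> + \<alpha> n *\<^sub>R grad \<phi> (p (Suc n) \<omega>)) \<in> borel_measurable (hist (Suc n))"
    by (intro measurable_cong) (simp add: q_Suc)
  then have "q (Suc n) \<in> borel_measurable (hist (Suc n))" by simp
  then show ?case by simp
qed

text \<open>In the pairing of the noise with the new gradient of \<phi>, splitting off the gradient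
  at y leaves the centred term \<open>m\<close>; the same splitting of the friction leaves
  \<open>N\<close>. Both errors are collected in \<open>R\<close>, with factor
  \<open>l * a\<^sup>2\<close>.\<close>

lemma one_step:
  fixes x y :: 'a
  assumes a: "0 \<le> a" "a \<le> a0" "C * a\<^sup>2 \<le> 1 / 2"
  defines "W' \<equiv> \<lambda>\<omega>. W (next_q a x y (\<xi> \<omega>)) (next_p a x y (\<xi> \<omega>))"
  shows "integrable M W'"
    and "(\<integral>\<omega>. W' \<omega> \<partial>M) \<le> (1 + (4 * C + 2 * l * C) * a\<^sup>2) * W x y - a * \<gamma> * (norm (grad \<phi> y))\<^sup>2"
proof -
  define R where "R \<omega> = norm (g x (\<xi> \<omega>) + \<gamma> *\<^sub>R grad \<phi> y)
        * (norm (grad F x - g x (\<xi> \<omega>)) + \<gamma> * norm (grad \<phi> y))" for \<omega>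
  define m where "m \<omega> = inner (grad \<phi> y) (grad F x - g x (\<xi> \<omega>))" for \<omega>
  define N where "N = (norm (grad \<phi> y))\<^sup>2"
  define w where "w = W x y"
  \<comment> \<open>The descent error contains the energy after the step; moving it to the left and
    dividing gives this factor, bounded by 1 + 2t for t = C a^2 at most 1/2.\<close>
  define \<kappa> where "\<kappa> = 1 / (1 - C * a\<^sup>2)"
  define Z where "Z \<omega> = \<kappa> * ((1 + C * a\<^sup>2) * w + a * m \<omega> - a * \<gamma> * N + l * a\<^sup>2 * R \<omega>)" for \<omega>
  have w: "1 \<le> w" unfolding w_def by (rule W_ge_1)
  have \<kappa>: "1 \<le> \<kappa>" "\<kappa> \<le> 1 + 2 * (C * a\<^sup>2)"
  proof -
    have c: "0 \<le> C * a\<^sup>2" using C by simp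
    then show "1 \<le> \<kappa>" using a(3) by (simp add: \<kappa>_def)
    have "C * a\<^sup>2 * (C * a\<^sup>2) \<le> 1 / 2 * (C * a\<^sup>2)" using a(3) c by (intro mult_right_mono) auto
    then have "1 \<le> (1 + 2 * (C * a\<^sup>2)) * (1 - C * a\<^sup>2)" by (simp add: algebra_simps)
    then show "\<kappa> \<le> 1 + 2 * (C * a\<^sup>2)" using a(3) by (simp add: \<kappa>_def divide_le_eq)
  qed
  have W': "W' \<omega> \<le> Z \<omega>" for \<omega>
  proof -
    define s where "s = \<xi> \<omega>"
    define P where "P = next_p a x y s"
    define Q where "Q = next_q a x y s"
    define D where "D = grad \<phi> P - grad \<phi> y"
    have Py: "P - y = - (a *\<^sub>R (g x s + \<gamma> *\<^sub>R grad \<phi> y))"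
      by (simp add: P_def next_p_def algebra_simps)
    have nD: "norm D \<le> l * a * norm (g x s + \<gamma> *\<^sub>R grad \<phi> y)"
    proof -
      have "norm D \<le> l * norm (P - y)" unfolding D_def using \<phi>_lip[of y P] by (simp add: norm_minus_commute)
      then show ?thesis using a(1) by (simp add: Py)
    qed
    have "\<phi> P - \<phi> y \<le> inner (grad \<phi> P) (P - y)" by (rule \<phi>_convex)
    also have "\<dots> = - a * inner (grad \<phi> P) (g x s) - a * \<gamma> * inner (grad \<phi> P) (grad \<phi> y)"
      by (simp add: Py inner_add_right algebra_simps)
    finally have 1: "\<phi> P - \<phi> y \<le> - a * inner (grad \<phi> P) (g x s) - a * \<gamma> * inner (grad \<phi> P) (grad \<phi> y)" .
    have 2: "F Q \<le> F x + a * inner (grad F x) (grad \<phi> P) + C * a\<^sup>2 * W x P"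
      using descent[OF a(1,2), of x P] by (simp add: Q_def next_q_def P_def)
    \<comment> \<open>The descent error mixes old position and new momentum, so its two gaps are
      charged to the old and to the new energy.\<close>
    have "W x P \<le> w + W Q P" using F_lower[of Q] \<phi>_lower[of y] by (simp add: W_def w_def)
    then have "C * a\<^sup>2 * W x P \<le> C * a\<^sup>2 * (w + W Q P)" using C by (intro mult_left_mono) auto
    with 1 2 have 3: "W Q P \<le> w + a * inner (grad \<phi> P) (grad F x - g x s)
        - a * \<gamma> * inner (grad \<phi> P) (grad \<phi> y) + C * a\<^sup>2 * (w + W Q P)"
      by (simp add: W_def w_def inner_diff_right inner_commute algebra_simps)
    have "inner (grad \<phi> P) (grad F x - g x s) = m \<omega> + inner D (grad F x - g x s)"
      by (simp add: m_def D_def s_def inner_diff_left)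
    also have "inner D (grad F x - g x s) \<le> norm D * norm (grad F x - g x s)"
      by (rule norm_cauchy_schwarz)
    also have "\<dots> \<le> l * a * norm (g x s + \<gamma> *\<^sub>R grad \<phi> y) * norm (grad F x - g x s)"
      using nD by (intro mult_right_mono) auto
    finally have 4: "inner (grad \<phi> P) (grad F x - g x s)
        \<le> m \<omega> + l * a * norm (g x s + \<gamma> *\<^sub>R grad \<phi> y) * norm (grad F x - g x s)" by simp
    have "- inner (grad \<phi> P) (grad \<phi> y) = - N + inner (- D) (grad \<phi> y)"
      by (simp add: D_def N_def inner_diff_left power2_norm_eq_inner)
    also have "inner (- D) (grad \<phi> y) \<le> norm (- D) * norm (grad \<phi> y)"
      by (rule norm_cauchy_schwarz)
    also have "\<dots> \<le> l * a * norm (g x s + \<gamma> *\<^sub>R grad \<phi> y) * norm (grad \<phi> y)"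
      using nD by (intro mult_right_mono) auto
    finally have 5: "- inner (grad \<phi> P) (grad \<phi> y)
        \<le> - N + l * a * norm (g x s + \<gamma> *\<^sub>R grad \<phi> y) * norm (grad \<phi> y)" by simp
    have "a * inner (grad \<phi> P) (grad F x - g x s) + a * \<gamma> * (- inner (grad \<phi> P) (grad \<phi> y))
      \<le> a * (m \<omega> + l * a * norm (g x s + \<gamma> *\<^sub>R grad \<phi> y) * norm (grad F x - g x s))
        + a * \<gamma> * (- N + l * a * norm (g x s + \<gamma> *\<^sub>R grad \<phi> y) * norm (grad \<phi> y))"
      using 4 5 a(1) \<gamma> by (intro add_mono mult_left_mono) auto
    also have "\<dots> = a * m \<omega> - a * \<gamma> * N + l * a\<^sup>2 * R \<omega>"
      by (simp add: R_def s_def algebra_simps power2_eq_square)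
    finally have "(1 - C * a\<^sup>2) * W Q P \<le> (1 + C * a\<^sup>2) * w + a * m \<omega> - a * \<gamma> * N + l * a\<^sup>2 * R \<omega>"
      using 3 by (simp add: algebra_simps)
    then have "W Q P \<le> Z \<omega>"
      using a(3) by (simp add: Z_def \<kappa>_def pos_le_divide_eq mult.commute)
    then show ?thesis by (simp add: W'_def Q_def P_def s_def)
  qed
  have gi: "integrable M (\<lambda>\<omega>. g x (\<xi> \<omega>))" "(\<integral>\<omega>. g x (\<xi> \<omega>) \<partial>M) = grad F x"
    using unbiased[of x] by (auto simp: has_bochner_integral_iff)
  have mi: "integrable M m" "(\<integral>\<omega>. m \<omega> \<partial>M) = 0"
    unfolding m_def using gi by (simp_all add: prob_space)
  have Ri: "integrable M R" "(\<integral>\<omega>. R \<omega> \<partial>M) \<le> C * w"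
    using noise_growth[of x y] by (simp_all add: R_def[abs_def] w_def)
  have Zi: "integrable M Z" unfolding Z_def using mi Ri by auto
  have W'_meas: "W' \<in> borel_measurable M"
    unfolding W'_def W_def next_q_def next_p_def by measurable
  show W'i: "integrable M W'"
  proof (rule Bochner_Integration.integrable_bound[OF Zi W'_meas])
    \<comment> \<open>Positivity of the energy makes the one-sided bound by Z a domination, and so
      gives integrability.\<close>
    have "norm (W' \<omega>) \<le> norm (Z \<omega>)" for \<omega>
      using W'[of \<omega>] W_ge_1[of "next_q a x y (\<xi> \<omega>)" "next_p a x y (\<xi> \<omega>)"] by (simp add: W'_def)
    then show "AE \<omega> in M. norm (W' \<omega>) \<le> norm (Z \<omega>)" by simp
  qed
  have "(\<integral>\<omega>. W' \<omega> \<partial>M) \<le> (\<integral>\<omega>. Z \<omega> \<partial>M)"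
    using W' by (intro integral_mono W'i Zi)
  also have "\<dots> = \<kappa> * ((1 + C * a\<^sup>2) * w - a * \<gamma> * N + l * a\<^sup>2 * (\<integral>\<omega>. R \<omega> \<partial>M))"
    unfolding Z_def using mi Ri by (simp add: prob_space)
  also have "\<dots> \<le> \<kappa> * ((1 + C * a\<^sup>2) * w - a * \<gamma> * N + l * a\<^sup>2 * (C * w))"
    using Ri \<kappa> l by (intro mult_left_mono add_left_mono) auto
  also have "\<dots> = \<kappa> * ((1 + (C + l * C) * a\<^sup>2) * w) - \<kappa> * (a * \<gamma> * N)" by (simp add: algebra_simps)
  \<comment> \<open>\<kappa> takes its upper bound on the growth term and its lower bound 1 on the
    dissipation, which enters with a minus sign.\<close>
  also have "\<dots> \<le> (1 + 2 * (C * a\<^sup>2)) * ((1 + (C + l * C) * a\<^sup>2) * w) - 1 * (a * \<gamma> * N)"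
    using \<kappa> a(1) \<gamma> w l C by (intro diff_mono mult_right_mono) (auto simp: N_def)
  also have "\<dots> \<le> (1 + (4 * C + 2 * l * C) * a\<^sup>2) * w - a * \<gamma> * N"
  proof -
    define d where "d = (C + l * C) * a\<^sup>2"
    have d: "0 \<le> d" using C l by (simp add: d_def)
    have "2 * (C * a\<^sup>2) * d \<le> 1 * d" using a(3) d by (intro mult_right_mono) auto
    then have "(1 + 2 * (C * a\<^sup>2)) * (1 + d) \<le> 1 + 2 * (C * a\<^sup>2) + 2 * d" by (simp add: algebra_simps)
    also have "\<dots> = 1 + (4 * C + 2 * l * C) * a\<^sup>2" by (simp add: d_def algebra_simps)
    finally have "(1 + 2 * (C * a\<^sup>2)) * (1 + d) * w \<le> (1 + (4 * C + 2 * l * C) * a\<^sup>2) * w"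
      using w by (intro mult_right_mono) auto
    then show ?thesis by (simp add: d_def mult.assoc)
  qed
  finally show "(\<integral>\<omega>. W' \<omega> \<partial>M) \<le> (1 + (4 * C + 2 * l * C) * a\<^sup>2) * W x y - a * \<gamma> * (norm (grad \<phi> y))\<^sup>2"
    by (simp add: w_def N_def)
qed

text \<open>Dividing by the accumulated growth \<open>A n\<close> and adding the discounted
  dissipation \<open>T n\<close> gives a supermartingale. Square summability of the steps keeps
  \<open>A n\<close> bounded, so a bound on it transfers to the energy, and coercivity bounds the
  iterates.\<close>

lemma energy_AE:
  "AE \<omega> in M. Bseq (\<lambda>n. p n \<omega>) \<and> Bseq (\<lambda>n. q n \<omega>) \<and> summable (\<lambda>n. \<alpha> n * (norm (grad \<phi> (p n \<omega>)))\<^sup>2)"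
proof -
  note pq[measurable] = conjunct1[OF iter_measurable] conjunct2[OF iter_measurable]
  define c where "c = 4 * C + 2 * l * C"
  have c: "0 \<le> c" using C l by (simp add: c_def)
  define A where "A n = (\<Prod>j<n. 1 + c * (\<alpha> j)\<^sup>2)" for n
  have A: "1 \<le> A n" "A (Suc n) = A n * (1 + c * (\<alpha> n)\<^sup>2)" for n
    unfolding A_def using c by (auto intro!: prod_ge_1)
  define Abar where "Abar = exp (\<Sum>j. c * (\<alpha> j)\<^sup>2)"
  have Abar: "A n \<le> Abar" for n
  proof -
    have "A n \<le> (\<Prod>j<n. exp (c * (\<alpha> j)\<^sup>2))"
      unfolding A_def using c by (intro prod_mono) (auto intro: exp_ge_add_one_self)
    also have "\<dots> = exp (\<Sum>j<n. c * (\<alpha> j)\<^sup>2)" by (simp add: exp_sum)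
    also have "\<dots> \<le> Abar" unfolding Abar_def using c \<alpha>_sq_sum
      by (simp only: exp_le_cancel_iff) (intro sum_le_suminf, auto intro: summable_mult)
    finally show ?thesis .
  qed
  have sq0: "(\<lambda>k. (\<alpha> k)\<^sup>2) \<longlonglongrightarrow> 0" by (rule summable_LIMSEQ_zero[OF \<alpha>_sq_sum])
  have sq1: "(\<lambda>k. C * (\<alpha> k)\<^sup>2) \<longlonglongrightarrow> 0" by (rule tendsto_mult_right_zero[OF sq0])
  \<comment> \<open>\<open>one_step\<close> needs small steps, hence the start at K.\<close>
  have "\<forall>\<^sub>F k in sequentially. C * (\<alpha> k)\<^sup>2 < 1 / 2 \<and> (\<alpha> k)\<^sup>2 < a0\<^sup>2"
    using a0 by (intro eventually_conj order_tendstoD(2)[OF sq1] order_tendstoD(2)[OF sq0]) auto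
  then obtain K where K': "\<And>k. k \<ge> K \<Longrightarrow> C * (\<alpha> k)\<^sup>2 < 1 / 2 \<and> (\<alpha> k)\<^sup>2 < a0\<^sup>2"
    unfolding eventually_sequentially by blast
  have K: "C * (\<alpha> k)\<^sup>2 \<le> 1 / 2" "\<alpha> k \<le> a0" if "k \<ge> K" for k
  proof -
    have *: "C * (\<alpha> k)\<^sup>2 < 1 / 2" "(\<alpha> k)\<^sup>2 < a0\<^sup>2" if "k \<ge> K" for k using that K' by auto
    show "C * (\<alpha> k)\<^sup>2 \<le> 1 / 2" using *(1)[OF that] by simp
    show "\<alpha> k \<le> a0" using power2_less_imp_less[OF *(2)[OF that]] a0 by simp
  qed
  define T where "T n \<omega> = (\<Sum>j<n. \<gamma> * \<alpha> j * (norm (grad \<phi> (p j \<omega>)))\<^sup>2 / A (Suc j))" for n \<omega>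
  define u where "u n \<omega> = W (q n \<omega>) (p n \<omega>) / A n + T n \<omega>" for n \<omega>
  have A0: "0 < A n" for n using A(1)[of n] by linarith
  have T0: "0 \<le> T n \<omega>" for n \<omega>
  proof -
    have "0 \<le> \<gamma> * \<alpha> j * (norm (grad \<phi> (p j \<omega>)))\<^sup>2 / A (Suc j)" for j
      by (intro divide_nonneg_pos[OF _ A0] mult_nonneg_nonneg[OF mult_nonneg_nonneg[OF less_imp_le[OF \<gamma>] \<alpha>_nonneg]]
          zero_le_power2)
    then show ?thesis unfolding T_def by (rule sum_nonneg)
  qed
  have [measurable]: "T n \<in> borel_measurable (hist n)" for n
    unfolding T_def
  proof (rule borel_measurable_sum)
    fix j assume "j \<in> {..<n}"
    then have [measurable]: "p j \<in> borel_measurable (hist n)" by (intro hist_mono[OF pq(1)]) simp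
    show "(\<lambda>\<omega>. \<gamma> * \<alpha> j * (norm (grad \<phi> (p j \<omega>)))\<^sup>2 / A (Suc j)) \<in> borel_measurable (hist n)"
      by measurable
  qed
  define h where "h n z = (case z of (((x, y), t), s) \<Rightarrow>
      ennreal (W (next_q (\<alpha> n) x y s) (next_p (\<alpha> n) x y s) / A (Suc n)
        + (t + \<gamma> * \<alpha> n * (norm (grad \<phi> y))\<^sup>2 / A (Suc n))))" for n and z :: "(('a \<times> 'a) \<times> real) \<times> 's"
  have sm: "supermart K (\<lambda>n \<omega>. ennreal (u n \<omega>))"
  proof (rule supermartI)
    show "(\<lambda>\<omega>. ennreal (u n \<omega>)) \<in> borel_measurable (hist n)" for n
      unfolding u_def W_def by measurable
    show "(\<lambda>\<omega>. ((q n \<omega>, p n \<omega>), T n \<omega>)) \<in> measurable (hist n) ((borel \<Otimes>\<^sub>M borel) \<Otimes>\<^sub>M borel)" for n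
      by measurable
    show "h n \<in> borel_measurable (((borel \<Otimes>\<^sub>M borel) \<Otimes>\<^sub>M borel) \<Otimes>\<^sub>M S)" for n
      unfolding h_def W_def next_q_def next_p_def by measurable
    show "ennreal (u (Suc n) \<omega>) = h n (((q n \<omega>, p n \<omega>), T n \<omega>), \<xi>s n \<omega>)" if "\<omega> \<in> space M" for n \<omega>
      using that by (simp add: u_def h_def T_def next_q_def next_p_def p_Suc q_Suc)
    fix n \<omega> assume n: "K \<le> n" and \<omega>: "\<omega> \<in> space M"
    define x y t where "x = q n \<omega>" and "y = p n \<omega>" and "t = T n \<omega>"
    define b where "b = \<gamma> * \<alpha> n * (norm (grad \<phi> y))\<^sup>2 / A (Suc n)"
    define W' where "W' \<omega> = W (next_q (\<alpha> n) x y (\<xi> \<omega>)) (next_p (\<alpha> n) x y (\<xi> \<omega>))" for \<omega>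
    note os = one_step[OF \<alpha>_nonneg K(2,1)[OF n], of x y, folded W'_def c_def]
    have W'1: "1 \<le> W' \<omega>'" for \<omega>' unfolding W'_def by (rule W_ge_1)
    have tb: "0 \<le> t" "0 \<le> b"
      using T0[of n \<omega>] \<gamma> \<alpha>_nonneg[of n] A0[of "Suc n"] by (simp_all add: t_def b_def)
    have int: "integrable M (\<lambda>\<omega>'. W' \<omega>' / A (Suc n) + (t + b))" using os(1) by simp
    have "(\<integral>\<^sup>+\<omega>'. h n (((q n \<omega>, p n \<omega>), T n \<omega>), \<xi> \<omega>') \<partial>M) = (\<integral>\<^sup>+\<omega>'. ennreal (W' \<omega>' / A (Suc n) + (t + b)) \<partial>M)"
      by (simp add: h_def W'_def x_def y_def t_def b_def)
    also have "\<dots> = ennreal (\<integral>\<omega>'. W' \<omega>' / A (Suc n) + (t + b) \<partial>M)"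
      using W'1 A0[of "Suc n"] tb
      by (intro nn_integral_eq_integral int AE_I2 add_nonneg_nonneg divide_nonneg_pos) (auto intro: order_trans[of 0 1])
    also have "(\<integral>\<omega>'. W' \<omega>' / A (Suc n) + (t + b) \<partial>M) = (\<integral>\<omega>'. W' \<omega>' \<partial>M) / A (Suc n) + (t + b)"
      using os(1) by (simp add: prob_space)
    also have "\<dots> \<le> ((1 + c * (\<alpha> n)\<^sup>2) * W x y - \<alpha> n * \<gamma> * (norm (grad \<phi> y))\<^sup>2) / A (Suc n) + (t + b)"
      using os(2) A0[of "Suc n"] by (intro add_right_mono divide_right_mono) auto
    \<comment> \<open>The increment b of the dissipation sum equals the energy loss divided by
      \<open>A (Suc n)\<close>, so the two cancel.\<close>
    also have "\<dots> = (1 + c * (\<alpha> n)\<^sup>2) * W x y / A (Suc n) + t"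
      by (simp add: b_def diff_divide_distrib mult.commute)
    also have "\<dots> = W x y / A n + t"
    proof -
      have "0 < 1 + c * (\<alpha> n)\<^sup>2" using c by (intro add_pos_nonneg) auto
      then show ?thesis by (simp add: A(2))
    qed
    also have "\<dots> = u n \<omega>" by (simp add: u_def x_def y_def t_def)
    finally show "(\<integral>\<^sup>+\<omega>'. h n (((q n \<omega>, p n \<omega>), T n \<omega>), \<xi> \<omega>') \<partial>M) \<le> ennreal (u n \<omega>)"
      by (simp add: ennreal_leI)
  qed
  have sub: "\<exists>R. \<forall>x. G x \<le> b \<longrightarrow> norm x \<le> R" if "filterlim G at_top at_infinity" for G :: "'a \<Rightarrow> real" and b
  proof -
    have "\<forall>\<^sub>F x in at_infinity. b < G x" using that by (simp add: filterlim_at_top_dense)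
    then show ?thesis unfolding eventually_at_infinity by (meson linorder_not_le nle_le)
  qed
  have "AE \<omega> in M. \<exists>j::nat. \<forall>n\<ge>K. ennreal (u n \<omega>) \<le> of_nat j"
    by (rule supermart_AE_bounded[OF sm]) simp
  then show ?thesis
  proof eventually_elim
    case (elim \<omega>)
    then obtain j :: nat where "\<And>n. n \<ge> K \<Longrightarrow> ennreal (u n \<omega>) \<le> of_nat j" by blast
    then have u: "u n \<omega> \<le> real j" if "n \<ge> K" for n
      using that by (simp add: ennreal_of_nat_eq_real_of_nat)
    have Wb: "W (q n \<omega>) (p n \<omega>) \<le> real j * Abar" and Tb: "T n \<omega> \<le> real j" if "n \<ge> K" for n
    proof -
      have W0: "0 \<le> W (q n \<omega>) (p n \<omega>)" using W_ge_1[of "q n \<omega>" "p n \<omega>"] by linarith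
      have "W (q n \<omega>) (p n \<omega>) / A n \<le> real j" using u[OF that] T0[of n \<omega>] by (simp add: u_def)
      then have "W (q n \<omega>) (p n \<omega>) \<le> real j * A n" using A0[of n] by (simp add: divide_le_eq)
      also have "\<dots> \<le> real j * Abar" using Abar by (intro mult_left_mono) auto
      finally show "W (q n \<omega>) (p n \<omega>) \<le> real j * Abar" .
      have "0 \<le> W (q n \<omega>) (p n \<omega>) / A n" using W0 A0[of n] by simp
      then show "T n \<omega> \<le> real j" using u[OF that] by (simp add: u_def)
    qed
    obtain R1 R2 where R1: "\<And>x. F x \<le> Fstar + real j * Abar \<Longrightarrow> norm x \<le> R1"
      and R2: "\<And>x. \<phi> x \<le> \<phi>star + real j * Abar \<Longrightarrow> norm x \<le> R2"
      using sub[OF F_coercive] sub[OF \<phi>_coercive] by metis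
    have "norm (q n \<omega>) \<le> R1" "norm (p n \<omega>) \<le> R2" if "n \<ge> K" for n
      using Wb[OF that] F_lower[of "q n \<omega>"] \<phi>_lower[of "p n \<omega>"]
      by (auto intro!: R1 R2 simp: W_def)
    then have "Bseq (\<lambda>n. q n \<omega>)" "Bseq (\<lambda>n. p n \<omega>)"
      by (auto intro!: BfunI[of "\<lambda>n. q n \<omega>" R1] BfunI[of "\<lambda>n. p n \<omega>" R2] eventually_sequentiallyI[of K])
    moreover have "summable (\<lambda>n. \<alpha> n * (norm (grad \<phi> (p n \<omega>)))\<^sup>2)"
    proof (rule summableI_nonneg_bounded)
      show "0 \<le> \<alpha> n * (norm (grad \<phi> (p n \<omega>)))\<^sup>2" for n using \<alpha>_nonneg by simp
      fix n
      \<comment> \<open>The bound on T is known from K on only; nonnegative terms allow the sum to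
        be extended to \<open>max n K\<close>.\<close>
      have "(\<Sum>j<n. \<alpha> j * (norm (grad \<phi> (p j \<omega>)))\<^sup>2)
          \<le> (\<Sum>j<max n K. \<alpha> j * (norm (grad \<phi> (p j \<omega>)))\<^sup>2)"
        using \<alpha>_nonneg by (intro sum_mono2) auto
      also have "\<dots> \<le> (\<Sum>j<max n K. Abar / \<gamma> * (\<gamma> * \<alpha> j * (norm (grad \<phi> (p j \<omega>)))\<^sup>2 / A (Suc j)))"
      proof (rule sum_mono)
        fix j
        define e where "e = \<alpha> j * (norm (grad \<phi> (p j \<omega>)))\<^sup>2"
        have "0 \<le> e" using \<alpha>_nonneg by (simp add: e_def)
        then have "e * A (Suc j) \<le> e * Abar" using Abar by (intro mult_left_mono) auto
        then have "e \<le> Abar / \<gamma> * (\<gamma> * e / A (Suc j))"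
          using A0[of "Suc j"] \<gamma> by (simp add: field_simps)
        then show "\<alpha> j * (norm (grad \<phi> (p j \<omega>)))\<^sup>2 \<le> Abar / \<gamma> * (\<gamma> * \<alpha> j * (norm (grad \<phi> (p j \<omega>)))\<^sup>2 / A (Suc j))"
          by (simp add: e_def mult.assoc)
      qed
      also have "\<dots> = Abar / \<gamma> * T (max n K) \<omega>" by (simp only: T_def sum_distrib_left)
      also have "\<dots> \<le> Abar / \<gamma> * real j"
        using Tb[of "max n K"] \<gamma> by (intro mult_left_mono) (auto simp: Abar_def)
      finally show "(\<Sum>j<n. \<alpha> j * (norm (grad \<phi> (p j \<omega>)))\<^sup>2) \<le> Abar / \<gamma> * real j" .
    qed
    ultimately show ?case by blast
  qed
qed

text \<open>The truncation depends on the current position alone, so the increments stay centred and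
  their variance is bounded on the ball. A bounded path has an integer R for which nothing is
  truncated, and countably many R leave one null set.\<close>

lemma noise_AE:
  "AE \<omega> in M. \<forall>R::nat. Cauchy (\<lambda>n. \<Sum>k<n. if norm (q k \<omega>) \<le> R
     then \<alpha> k *\<^sub>R (grad F (q k \<omega>) - g (q k \<omega>) (\<xi>s k \<omega>)) else 0)"
proof (subst AE_all_countable, intro allI)
  fix R :: nat
  obtain v where v: "0 \<le> v" "\<And>x. norm x \<le> real R \<Longrightarrow>
      (\<integral>\<^sup>+\<omega>. ennreal ((norm (grad F x - g x (\<xi> \<omega>)))\<^sup>2) \<partial>M) \<le> ennreal v"
    using local_variance[of "real R"] by blast
  define D where "D k z = (if norm (fst z) \<le> real R then \<alpha> k *\<^sub>R (grad F (fst z) - g (fst z) (snd z)) else 0)"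
    for k and z :: "'a \<times> 's"
  have "AE \<omega> in M. Cauchy (\<lambda>n. \<Sum>k<n. D k (q k \<omega>, \<xi>s k \<omega>))"
  proof (rule noise_sum_Cauchy)
    show "q n \<in> borel_measurable (hist n)" for n using iter_measurable by blast
    show "D n \<in> borel_measurable (borel \<Otimes>\<^sub>M S)" for n
      unfolding D_def by measurable
    show "summable (\<lambda>n. v * (\<alpha> n)\<^sup>2)" using \<alpha>_sq_sum by (rule summable_mult)
    show "0 \<le> v * (\<alpha> n)\<^sup>2" for n using v(1) by simp
    fix n \<omega>
    define x where "x = q n \<omega>"
    have "has_bochner_integral M (\<lambda>\<omega>'. \<alpha> n *\<^sub>R (grad F x - g x (\<xi> \<omega>'))) (\<alpha> n *\<^sub>R (grad F x - grad F x))"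
      using unbiased[of x]       by (intro has_bochner_integral_scaleR_right has_bochner_integral_diff) (auto simp: has_bochner_integral_iff prob_space)
    then show "has_bochner_integral M (\<lambda>\<omega>'. D n (q n \<omega>, \<xi> \<omega>')) 0"
      by (cases "norm x \<le> real R") (auto simp: D_def x_def)
    show "(\<integral>\<^sup>+\<omega>'. ennreal ((norm (D n (q n \<omega>, \<xi> \<omega>')))\<^sup>2) \<partial>M) \<le> ennreal (v * (\<alpha> n)\<^sup>2)"
    proof (cases "norm x \<le> real R")
      case True
      have "(\<integral>\<^sup>+\<omega>'. ennreal ((norm (D n (q n \<omega>, \<xi> \<omega>')))\<^sup>2) \<partial>M)
          = (\<integral>\<^sup>+\<omega>'. ennreal ((\<alpha> n)\<^sup>2) * ennreal ((norm (grad F x - g x (\<xi> \<omega>')))\<^sup>2) \<partial>M)"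
        using True by (intro nn_integral_cong) (auto simp: D_def x_def power_mult_distrib ennreal_mult)
      also have "\<dots> = ennreal ((\<alpha> n)\<^sup>2) * (\<integral>\<^sup>+\<omega>'. ennreal ((norm (grad F x - g x (\<xi> \<omega>')))\<^sup>2) \<partial>M)"
        by (intro nn_integral_cmult) measurable
      also have "\<dots> \<le> ennreal ((\<alpha> n)\<^sup>2) * ennreal v" using v(2)[OF True] by (intro mult_left_mono) auto
      also have "\<dots> = ennreal (v * (\<alpha> n)\<^sup>2)" using v(1) by (simp add: ennreal_mult mult.commute)
      finally show ?thesis .
    qed (auto simp: D_def x_def)
  qed
  then show "AE \<omega> in M. Cauchy (\<lambda>n. \<Sum>k<n. if norm (q k \<omega>) \<le> real R
     then \<alpha> k *\<^sub>R (grad F (q k \<omega>) - g (q k \<omega>) (\<xi>s k \<omega>)) else 0)"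
    by (simp add: D_def cong: if_cong)
qed

text \<open>Writing g as grad F minus the deviation turns each path into a deterministic recursion
  with Cauchy noise. The limit of grad \<phi>(p) comes first, because it serves as vanishing damping
  and as vanishing velocity of q in the second limit.\<close>

lemma gradient_tendsto_AE:
  "AE \<omega> in M. Bseq (\<lambda>n. q n \<omega>) \<and> (\<lambda>n. grad F (q n \<omega>)) \<longlonglongrightarrow> 0
     \<and> (\<lambda>n. dist (q (Suc n) \<omega>) (q n \<omega>)) \<longlonglongrightarrow> 0"
  using energy_AE noise_AE AE_space
proof eventually_elim
  case (elim \<omega>)
  note \<omega> = elim(3)
  obtain R1 R2 where "\<And>n. norm (p n \<omega>) \<le> R1" "\<And>n. norm (q n \<omega>) \<le> R2"
    using elim(1) unfolding Bseq_def by blast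
  moreover obtain R :: nat where "max R1 R2 \<le> real R" using real_arch_simple by blast
  ultimately have R: "norm (p n \<omega>) \<le> real R" "norm (q n \<omega>) \<le> real R" for n
    by (meson max.boundedE order_trans)+
  define d where "d k = \<alpha> k *\<^sub>R (grad F (q k \<omega>) - g (q k \<omega>) (\<xi>s k \<omega>))" for k
  have noise: "Cauchy (\<lambda>n. \<Sum>k<n. d k)"
    using elim(2)[rule_format, of R] R(2) by (simp add: d_def)
  have "compact (grad F ` cball 0 (real R))"
    using grad_F_cont by (intro compact_continuous_image) (auto intro: continuous_on_subset)
  then obtain B1 where "\<forall>x\<in>cball 0 (real R). norm (grad F x) \<le> B1"
    by (auto dest!: compact_imp_bounded simp: bounded_iff)
  then have B1: "norm (grad F x) \<le> B1" if "norm x \<le> real R" for x using that by simp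
  have "compact (grad \<phi> ` cball 0 (real R))"
    using continuous_grad_\<phi> by (intro compact_continuous_image) (auto intro: continuous_on_subset)
  then obtain B2 where "\<forall>x\<in>cball 0 (real R). norm (grad \<phi> x) \<le> B2"
    by (auto dest!: compact_imp_bounded simp: bounded_iff)
  then have B2: "norm (grad \<phi> x) \<le> B2" if "norm x \<le> real R" for x using that by simp
  have \<phi>0: "(\<lambda>k. grad \<phi> (p k \<omega>)) \<longlonglongrightarrow> 0"
  proof (rule lipschitz_field_tendsto_zero[where G = "grad \<phi>" and x = "\<lambda>k. p k \<omega>" and d = d
        and b = "\<lambda>k. - grad F (q k \<omega>) - \<gamma> *\<^sub>R grad \<phi> (p k \<omega>)", OF \<alpha>_nonneg \<alpha>_sum])
    show "p (Suc k) \<omega> = p k \<omega> + \<alpha> k *\<^sub>R (- grad F (q k \<omega>) - \<gamma> *\<^sub>R grad \<phi> (p k \<omega>)) + d k" for k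
      using \<omega> by (simp add: p_Suc d_def algebra_simps)
    show "norm (- grad F (q k \<omega>) - \<gamma> *\<^sub>R grad \<phi> (p k \<omega>)) \<le> B1 + \<gamma> * B2" for k
    proof -
      have "norm (- grad F (q k \<omega>) - \<gamma> *\<^sub>R grad \<phi> (p k \<omega>))
          \<le> norm (- grad F (q k \<omega>)) + norm (\<gamma> *\<^sub>R grad \<phi> (p k \<omega>))" by (rule norm_triangle_ineq4)
      also have "\<dots> \<le> B1 + \<gamma> * B2"
        using \<gamma> B1[OF R(2)[of k]] B2[OF R(1)[of k]] by (intro add_mono) auto
      finally show ?thesis .
    qed
    show "norm (grad \<phi> u - grad \<phi> v) \<le> l * norm (u - v)" for u v
      using \<phi>_lip[of u v] by (simp add: norm_minus_commute)
  qed (use noise l elim(1) in auto)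
  have "(\<lambda>k. (\<alpha> k)\<^sup>2) \<longlonglongrightarrow> 0" by (rule summable_LIMSEQ_zero[OF \<alpha>_sq_sum])
  then have "(\<lambda>k. sqrt ((\<alpha> k)\<^sup>2)) \<longlonglongrightarrow> sqrt 0" by (rule tendsto_real_sqrt)
  then have \<alpha>0: "\<alpha> \<longlonglongrightarrow> 0" using \<alpha>_nonneg by simp
  then obtain A where A: "\<And>k. norm (\<alpha> k) \<le> A"
    using convergent_imp_Bseq[of \<alpha>] unfolding convergent_def Bseq_def by blast
  have "(\<lambda>n. grad F (q n \<omega>)) \<longlonglongrightarrow> 0"
  proof (rule driving_field_tendsto_zero[where H = "grad F" and x = "\<lambda>k. p k \<omega>" and y = "\<lambda>k. q k \<omega>"
        and d = d and c = "\<lambda>k. \<gamma> *\<^sub>R grad \<phi> (p k \<omega>)" and b = "\<lambda>k. grad \<phi> (p (Suc k) \<omega>)",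
        OF \<alpha>_nonneg \<alpha>_sum])
    show "\<alpha> k \<le> A" for k using A[of k] by simp
    show "p (Suc k) \<omega> = p k \<omega> - \<alpha> k *\<^sub>R grad F (q k \<omega>) - \<alpha> k *\<^sub>R (\<gamma> *\<^sub>R grad \<phi> (p k \<omega>)) + d k" for k
      using \<omega> by (simp add: p_Suc d_def algebra_simps)
    show "q (Suc k) \<omega> = q k \<omega> + \<alpha> k *\<^sub>R grad \<phi> (p (Suc k) \<omega>)" for k using \<omega> by (rule q_Suc)
    show "(\<lambda>k. \<gamma> *\<^sub>R grad \<phi> (p k \<omega>)) \<longlonglongrightarrow> 0" using tendsto_scaleR[OF tendsto_const \<phi>0] by simp
    \<comment> \<open>The velocity of q uses the updated momentum, hence the shift.\<close>
    show "(\<lambda>k. grad \<phi> (p (Suc k) \<omega>)) \<longlonglongrightarrow> 0" by (rule LIMSEQ_Suc[OF \<phi>0])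
  qed (use noise grad_F_cont R in auto)
  moreover have "(\<lambda>n. dist (q (Suc n) \<omega>) (q n \<omega>)) \<longlonglongrightarrow> 0"
  proof -
    have "(\<lambda>n. norm (\<alpha> n *\<^sub>R grad \<phi> (p (Suc n) \<omega>))) \<longlonglongrightarrow> norm (0 *\<^sub>R (0::'a))"
      by (intro tendsto_intros \<alpha>0 LIMSEQ_Suc[OF \<phi>0])
    then show ?thesis using \<omega> by (simp add: q_Suc dist_norm)
  qed
  ultimately show ?case using elim(1) by blast
qed

lemma stationary_AE:
  "AE \<omega> in M. (\<lambda>k. infdist (q k \<omega>) (stationary_points F)) \<longlonglongrightarrow> 0"
  "(\<And>x. x \<in> stationary_points F \<Longrightarrow> x isolated_in stationary_points F) \<Longrightarrow>
    AE \<omega> in M. \<exists>x\<in>stationary_points F. (\<lambda>k. q k \<omega>) \<longlonglongrightarrow> x"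
proof -
  have near: "\<forall>\<^sub>F k in sequentially. \<exists>z\<in>stationary_points F. dist (q k \<omega>) z < e"
    if bd: "Bseq (\<lambda>n. q n \<omega>)" and lim: "(\<lambda>n. grad F (q n \<omega>)) \<longlonglongrightarrow> 0" and e: "0 < e" for \<omega> e
  proof -
    obtain R where "\<And>n. norm (q n \<omega>) \<le> R" using bd unfolding Bseq_def by blast
    from bounded_seq_near_zeros[OF grad_F_cont this lim e]
    show ?thesis by (simp add: stationary_points_def)
  qed
  show "AE \<omega> in M. (\<lambda>k. infdist (q k \<omega>) (stationary_points F)) \<longlonglongrightarrow> 0"
    using gradient_tendsto_AE by eventually_elim (intro infdist_tendsto_zero near; simp)
  assume isol: "\<And>x. x \<in> stationary_points F \<Longrightarrow> x isolated_in stationary_points F"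
  have "closed (grad F -` {0})"
    using grad_F_cont by (intro continuous_closed_vimage) (auto simp: continuous_on_eq_continuous_at)
  then have cl: "closed (stationary_points F)"
    by (simp add: stationary_points_def vimage_def)
  show "AE \<omega> in M. \<exists>x\<in>stationary_points F. (\<lambda>k. q k \<omega>) \<longlonglongrightarrow> x"
    using gradient_tendsto_AE
  proof eventually_elim
    case (elim \<omega>)
    then obtain R where "\<And>n. norm (q n \<omega>) \<le> R" unfolding Bseq_def by blast
    with elim show ?case by (intro converges_to_isolated_point[OF near cl] isol) auto
  qed
qed

end

section \<open>The three settings\<close>

lemma sq_sum3_le: "(a + b + c)\<^sup>2 \<le> 3 * (a\<^sup>2 + b\<^sup>2 + c\<^sup>2)" for a b c :: real
proof -
  have "0 \<le> (a - b)\<^sup>2 + (b - c)\<^sup>2 + (a - c)\<^sup>2" by simp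
  then show ?thesis by (simp add: power2_eq_square algebra_simps)
qed

text \<open>No iterates occur here: the settings are compared at one position, one momentum and the
  generic sample.\<close>

locale energy_setup = prob_space M
  for M :: "'w measure" +
  fixes \<xi> :: "'w \<Rightarrow> 's" and F \<phi> :: "'a::euclidean_space \<Rightarrow> real"
    and g :: "'a \<Rightarrow> 's \<Rightarrow> 'a" and \<gamma> Fstar \<phi>star l :: real and W :: "'a \<Rightarrow> 'a \<Rightarrow> real"
  defines "W \<equiv> \<lambda>x y. 1 + (F x - Fstar) + (\<phi> y - \<phi>star)"
  assumes F_diff: "\<And>x. F differentiable (at x)"
    and \<phi>_diff: "\<And>x. \<phi> differentiable (at x)"
    and \<gamma>: "0 < \<gamma>"
    and F_lower: "\<And>x. Fstar \<le> F x"
    and unbiased: "\<And>x. has_bochner_integral M (\<lambda>\<omega>. g x (\<xi> \<omega>)) (grad F x)"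
    and l: "0 < l" and \<phi>_lip: "\<And>x y. norm (grad \<phi> y - grad \<phi> x) \<le> l * norm (x - y)"
    and \<phi>_lower: "\<And>x. \<phi>star \<le> \<phi> x"
begin

definition deviation :: "'a \<Rightarrow> 'w \<Rightarrow> real" where
  "deviation x \<omega> = norm (grad F x - g x (\<xi> \<omega>))"

definition cross_term :: "'a \<Rightarrow> 'a \<Rightarrow> 'w \<Rightarrow> real" where
  "cross_term x y \<omega> = norm (g x (\<xi> \<omega>) + \<gamma> *\<^sub>R grad \<phi> y)
        * (norm (grad F x - g x (\<xi> \<omega>)) + \<gamma> * norm (grad \<phi> y))"

text \<open>
  What the energy estimate needs from \<open>F\<close>, \<open>\<phi>\<close> and \<open>g\<close>; each of the three settings supplies it for
  some constants. As \<open>W \<ge> 1\<close>, bounds by \<open>C * W\<close> absorb additive constants.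
\<close>

definition controlled :: "real \<Rightarrow> real \<Rightarrow> bool" where
  "controlled C a0 \<longleftrightarrow> 0 \<le> C \<and> 0 < a0 \<and>
    (\<forall>a x y. 0 \<le> a \<longrightarrow> a \<le> a0 \<longrightarrow>
      F (x + a *\<^sub>R grad \<phi> y) \<le> F x + a * inner (grad F x) (grad \<phi> y) + C * a\<^sup>2 * W x y) \<and>
    (\<forall>x y. integrable M (cross_term x y) \<and> (\<integral>\<omega>. cross_term x y \<omega> \<partial>M) \<le> C * W x y) \<and>
    (\<forall>r. \<exists>v\<ge>0. \<forall>x. norm x \<le> r \<longrightarrow> (\<integral>\<^sup>+\<omega>. ennreal ((deviation x \<omega>)\<^sup>2) \<partial>M) \<le> ennreal v)"

section \<open>Bounds common to the settings\<close>

lemma W_ge: "1 \<le> W x y" "F x - Fstar \<le> W x y" "1 + (F x - Fstar) \<le> W x y" "\<phi> y - \<phi>star \<le> W x y"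
  using F_lower[of x] \<phi>_lower[of y] by (auto simp: W_def)

lemma controlledI:
  assumes C: "0 \<le> C1" "0 \<le> C2" and a0: "0 < a0"
    and descent: "\<And>a x y. 0 \<le> a \<Longrightarrow> a \<le> a0 \<Longrightarrow>
      F (x + a *\<^sub>R grad \<phi> y) \<le> F x + a * inner (grad F x) (grad \<phi> y) + C1 * a\<^sup>2 * W x y"
    and int: "\<And>x y. integrable M (cross_term x y)" and le: "\<And>x y. (\<integral>\<omega>. cross_term x y \<omega> \<partial>M) \<le> C2 * W x y"
    and var: "\<And>r. \<exists>v\<ge>0. \<forall>x. norm x \<le> r \<longrightarrow> (\<integral>\<^sup>+\<omega>. ennreal ((deviation x \<omega>)\<^sup>2) \<partial>M) \<le> ennreal v"
  shows "\<exists>C a0. controlled C a0"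
proof (intro exI)
  have W: "0 \<le> W x y" for x y using W_ge(1)[of x y] by linarith
  have d: "F (x + a *\<^sub>R grad \<phi> y) \<le> F x + a * inner (grad F x) (grad \<phi> y) + (C1 + C2) * a\<^sup>2 * W x y"
    if "0 \<le> a" "a \<le> a0" for a x y
  proof -
    have "C1 * a\<^sup>2 * W x y \<le> (C1 + C2) * a\<^sup>2 * W x y"
      using C W by (intro mult_right_mono) auto
    then show ?thesis using descent[OF that, of x y] by linarith
  qed
  have r: "(\<integral>\<omega>. cross_term x y \<omega> \<partial>M) \<le> (C1 + C2) * W x y" for x y
  proof -
    have "C2 * W x y \<le> (C1 + C2) * W x y" using C W by (intro mult_right_mono) auto
    then show ?thesis using le[of x y] by linarith
  qed
  show "controlled (C1 + C2) a0"
    unfolding controlled_def using C a0 int var d r by auto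
qed

lemma F_local_bound: "\<exists>B\<ge>0. \<forall>x. norm x \<le> r \<longrightarrow> F x - Fstar \<le> B"
proof -
  have "continuous_on (cball 0 r) F"
    using F_diff by (auto intro!: continuous_at_imp_continuous_on differentiable_imp_continuous_within)
  then have "compact (F ` cball 0 r)" by (intro compact_continuous_image) auto
  then obtain b where b: "\<forall>x\<in>cball 0 r. \<bar>F x\<bar> \<le> b"
    by (auto dest!: compact_imp_bounded simp: bounded_iff)
  have "F x - Fstar \<le> \<bar>b - Fstar\<bar>" if "norm x \<le> r" for x
    using bspec[OF b, of x] that by auto
  then show ?thesis by (intro exI[of _ "\<bar>b - Fstar\<bar>"]) auto
qed

lemma grad_\<phi>_sq: "(norm (grad \<phi> y))\<^sup>2 \<le> 4 * l * W x y"
proof -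
  have "(norm (grad \<phi> y))\<^sup>2 \<le> 4 * l * (\<phi> y - \<phi>star)"
    by (rule grad_sq_le_of_lipschitz[OF \<phi>_diff \<phi>_lip l \<phi>_lower])
  also have "\<dots> \<le> 4 * l * W x y" using l W_ge by (intro mult_left_mono) auto
  finally show ?thesis .
qed

lemma g_int: "integrable M (\<lambda>\<omega>. g x (\<xi> \<omega>))" "(\<integral>\<omega>. g x (\<xi> \<omega>) \<partial>M) = grad F x"
  using unbiased[of x] by (auto simp: has_bochner_integral_iff)

lemma g_meas[measurable]: "(\<lambda>\<omega>. g x (\<xi> \<omega>)) \<in> borel_measurable M"
  using g_int(1) by (rule borel_measurable_integrable)

lemma deviation_int: "integrable M (deviation x)"
  unfolding deviation_def[abs_def] using g_int by (intro integrable_norm Bochner_Integration.integrable_diff) auto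

lemma deviation_nonneg: "0 \<le> deviation x \<omega>"
  by (simp add: deviation_def)

lemma cross_term_meas: "cross_term x y \<in> borel_measurable M"
  unfolding cross_term_def by measurable

lemma cross_term_nonneg: "0 \<le> cross_term x y \<omega>"
  using \<gamma> by (simp add: cross_term_def)

text \<open>Variance hypotheses control the deviation, so g is rewritten as grad F minus the
  deviation.\<close>

lemma cross_term_le: "cross_term x y \<omega> \<le> (deviation x \<omega> + norm (grad F x) + \<gamma> * norm (grad \<phi> y)) * (deviation x \<omega> + \<gamma> * norm (grad \<phi> y))"
  unfolding cross_term_def deviation_def
proof (rule mult_right_mono)
  have "norm (g x (\<xi> \<omega>) + \<gamma> *\<^sub>R grad \<phi> y)
      = norm (grad F x - (grad F x - g x (\<xi> \<omega>)) + \<gamma> *\<^sub>R grad \<phi> y)" by simp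
  also have "\<dots> \<le> norm (grad F x) + norm (grad F x - g x (\<xi> \<omega>)) + norm (\<gamma> *\<^sub>R grad \<phi> y)"
    by (intro norm_triangle_mono norm_triangle_ineq4 order_refl)
  finally show "norm (g x (\<xi> \<omega>) + \<gamma> *\<^sub>R grad \<phi> y)
      \<le> norm (grad F x - g x (\<xi> \<omega>)) + norm (grad F x) + \<gamma> * norm (grad \<phi> y)" using \<gamma> by simp
qed (use \<gamma> in simp)

lemma cross_term_integral_le:
  assumes "integrable M B" and "\<And>\<omega>. \<omega> \<in> space M \<Longrightarrow> cross_term x y \<omega> \<le> B \<omega>"
  shows "integrable M (cross_term x y)" "(\<integral>\<omega>. cross_term x y \<omega> \<partial>M) \<le> (\<integral>\<omega>. B \<omega> \<partial>M)"
proof -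
  show 1: "integrable M (cross_term x y)"
  proof (rule Bochner_Integration.integrable_bound[OF assms(1) cross_term_meas])
    show "AE \<omega> in M. norm (cross_term x y \<omega>) \<le> norm (B \<omega>)"
    proof (rule AE_I2)
      fix \<omega> assume "\<omega> \<in> space M"
      from assms(2)[OF this] cross_term_nonneg[of x y \<omega>]
      show "norm (cross_term x y \<omega>) \<le> norm (B \<omega>)" by simp
    qed
  qed
  show "(\<integral>\<omega>. cross_term x y \<omega> \<partial>M) \<le> (\<integral>\<omega>. B \<omega> \<partial>M)"
    by (rule integral_mono[OF 1 assms])
qed

lemma deviation_sq:
  assumes "integrable M (\<lambda>\<omega>. (norm (g x (\<xi> \<omega>)))\<^sup>2)"
  shows "integrable M (\<lambda>\<omega>. (deviation x \<omega>)\<^sup>2)" "(\<integral>\<omega>. (deviation x \<omega>)\<^sup>2 \<partial>M) = grad_variance M \<xi> F g x"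
proof -
  have eq: "(deviation x \<omega>)\<^sup>2 = (norm (grad F x))\<^sup>2 - 2 * inner (grad F x) (g x (\<xi> \<omega>)) + (norm (g x (\<xi> \<omega>)))\<^sup>2" for \<omega>
    by (simp add: deviation_def power2_norm_eq_inner inner_diff_left inner_diff_right inner_commute)
  show "integrable M (\<lambda>\<omega>. (deviation x \<omega>)\<^sup>2)" unfolding eq using assms g_int by auto
  have "(\<integral>\<omega>. (deviation x \<omega>)\<^sup>2 \<partial>M) = (norm (grad F x))\<^sup>2 - 2 * inner (grad F x) (grad F x) + (\<integral>\<omega>. (norm (g x (\<xi> \<omega>)))\<^sup>2 \<partial>M)"
    unfolding eq using assms g_int by (simp add: prob_space)
  then show "(\<integral>\<omega>. (deviation x \<omega>)\<^sup>2 \<partial>M) = grad_variance M \<xi> F g x"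
    by (simp add: grad_variance_def power2_norm_eq_inner)
qed

lemma deviation_sq_local:
  assumes int: "\<And>x. integrable M (\<lambda>\<omega>. (norm (g x (\<xi> \<omega>)))\<^sup>2)"
    and le: "\<And>x. norm x \<le> r \<Longrightarrow> grad_variance M \<xi> F g x \<le> v" and v: "0 \<le> v"
  shows "\<exists>v\<ge>0. \<forall>x. norm x \<le> r \<longrightarrow> (\<integral>\<^sup>+\<omega>. ennreal ((deviation x \<omega>)\<^sup>2) \<partial>M) \<le> ennreal v"
proof (intro exI[of _ v] conjI v allI impI)
  fix x :: 'a assume "norm x \<le> r"
  from le[OF this] show "(\<integral>\<^sup>+\<omega>. ennreal ((deviation x \<omega>)\<^sup>2) \<partial>M) \<le> ennreal v"
    using deviation_sq[OF int, of x] by (simp add: nn_integral_eq_integral ennreal_leI)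
qed

text \<open>Squared gradients of F and \<phi> are linear in their gaps, and so is the variance, its
  \<tau> part included. The product in the cross term is at most a full square, hence at most three
  times a sum of squares, each linear in W in mean.\<close>

lemma controlled_lipschitz:
  assumes L: "0 < L" and lip: "\<And>x y. norm (grad F y - grad F x) \<le> L * norm (x - y)"
    and c: "0 \<le> \<kappa>" "0 \<le> \<tau>"
    and int: "\<And>x. integrable M (\<lambda>\<omega>. (norm (g x (\<xi> \<omega>)))\<^sup>2)"
    and var: "\<And>x. grad_variance M \<xi> F g x \<le> \<kappa> * (F x - Fstar) + \<tau> * (norm (grad F x))\<^sup>2 + \<sigma>\<^sup>2"
  shows "\<exists>C a0. controlled C a0"
proof -
  have gsq: "(norm (grad F x))\<^sup>2 \<le> 4 * L * (F x - Fstar)" for x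
    by (rule grad_sq_le_of_lipschitz[OF F_diff lip L F_lower])
  have var': "grad_variance M \<xi> F g x \<le> (\<kappa> + \<tau> * (4 * L)) * (F x - Fstar) + \<sigma>\<^sup>2" for x
    using var[of x] mult_left_mono[OF gsq[of x] c(2)] by (simp add: algebra_simps)
  define D where "D = 3 * (\<kappa> + \<tau> * (4 * L) + \<sigma>\<^sup>2 + 4 * L + \<gamma>\<^sup>2 * (4 * l))"
  define B where "B x y \<omega> = 3 * ((deviation x \<omega>)\<^sup>2 + (norm (grad F x))\<^sup>2 + (\<gamma> * norm (grad \<phi> y))\<^sup>2)" for x y \<omega>
  have RB: "cross_term x y \<omega> \<le> B x y \<omega>" for x y \<omega>
  proof -
    have "cross_term x y \<omega> \<le> (deviation x \<omega> + norm (grad F x) + \<gamma> * norm (grad \<phi> y)) * (deviation x \<omega> + \<gamma> * norm (grad \<phi> y))"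
      by (rule cross_term_le)
    also have "\<dots> \<le> (deviation x \<omega> + norm (grad F x) + \<gamma> * norm (grad \<phi> y)) * (deviation x \<omega> + norm (grad F x) + \<gamma> * norm (grad \<phi> y))"
      using \<gamma> deviation_nonneg by (intro mult_left_mono) auto
    also have "\<dots> = (deviation x \<omega> + norm (grad F x) + \<gamma> * norm (grad \<phi> y))\<^sup>2" by (simp add: power2_eq_square)
    also have "\<dots> \<le> B x y \<omega>" unfolding B_def by (rule sq_sum3_le)
    finally show ?thesis .
  qed
  have Bi: "integrable M (B x y)" for x y
    unfolding B_def[abs_def] using deviation_sq(1)[OF int] by auto
  have BW: "(\<integral>\<omega>. B x y \<omega> \<partial>M) \<le> D * W x y" for x y
  proof -
    have "(\<integral>\<omega>. B x y \<omega> \<partial>M) = 3 * (grad_variance M \<xi> F g x + (norm (grad F x))\<^sup>2 + \<gamma>\<^sup>2 * (norm (grad \<phi> y))\<^sup>2)"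
      unfolding B_def using deviation_sq[OF int] by (simp add: prob_space power_mult_distrib)
    also have "\<dots> \<le> 3 * (((\<kappa> + \<tau> * (4 * L)) * W x y + \<sigma>\<^sup>2 * W x y) + 4 * L * W x y + \<gamma>\<^sup>2 * (4 * l * W x y))"
    proof (intro mult_left_mono add_mono grad_\<phi>_sq)
      have "(\<kappa> + \<tau> * (4 * L)) * (F x - Fstar) \<le> (\<kappa> + \<tau> * (4 * L)) * W x y"
        using c L W_ge(2)[of x y] by (intro mult_left_mono) auto
      moreover have "\<sigma>\<^sup>2 * 1 \<le> \<sigma>\<^sup>2 * W x y" using W_ge(1) by (intro mult_left_mono) auto
      ultimately show "grad_variance M \<xi> F g x \<le> (\<kappa> + \<tau> * (4 * L)) * W x y + \<sigma>\<^sup>2 * W x y"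
        using var'[of x] by linarith
      have "4 * L * (F x - Fstar) \<le> 4 * L * W x y" using L W_ge(2)[of x y] by (intro mult_left_mono) auto
      then show "(norm (grad F x))\<^sup>2 \<le> 4 * L * W x y" using gsq[of x] by linarith
    qed auto
    also have "\<dots> = D * W x y" by (simp add: D_def algebra_simps)
    finally show ?thesis .
  qed
  show ?thesis
  proof (rule controlledI)
    show "0 \<le> 4 * L * l" "0 \<le> D" "(0::real) < 1" using L l c \<gamma> by (auto simp: D_def)
    show "integrable M (cross_term x y)" for x y by (rule cross_term_integral_le(1)[OF Bi RB])
    show "(\<integral>\<omega>. cross_term x y \<omega> \<partial>M) \<le> D * W x y" for x y
      using cross_term_integral_le(2)[OF Bi RB, of x y] BW[of x y] by linarith
    show "F (x + a *\<^sub>R grad \<phi> y) \<le> F x + a * inner (grad F x) (grad \<phi> y) + 4 * L * l * a\<^sup>2 * W x y"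
      if "0 \<le> a" for a x y
    proof -
      have "F (x + a *\<^sub>R grad \<phi> y) \<le> F x + inner (grad F x) (a *\<^sub>R grad \<phi> y) + L * (norm (a *\<^sub>R grad \<phi> y))\<^sup>2"
        using lip[of x] L by (intro descent_of_local_lipschitz[OF F_diff]) (auto simp: norm_minus_commute)
      also have "L * (norm (a *\<^sub>R grad \<phi> y))\<^sup>2 = (L * a\<^sup>2) * (norm (grad \<phi> y))\<^sup>2" by (simp add: power_mult_distrib)
      also have "\<dots> \<le> (L * a\<^sup>2) * (4 * l * W x y)" using L by (intro mult_left_mono grad_\<phi>_sq) auto
      finally show ?thesis by (simp add: algebra_simps)
    qed
    fix r
    obtain b where b: "0 \<le> b" "\<And>x. norm x \<le> r \<Longrightarrow> F x - Fstar \<le> b" using F_local_bound by blast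
    have "grad_variance M \<xi> F g x \<le> (\<kappa> + \<tau> * (4 * L)) * b + \<sigma>\<^sup>2" if "norm x \<le> r" for x
    proof -
      have "(\<kappa> + \<tau> * (4 * L)) * (F x - Fstar) \<le> (\<kappa> + \<tau> * (4 * L)) * b"
        using c L b(2)[OF that] by (intro mult_left_mono) auto
      then show ?thesis using var'[of x] by linarith
    qed
    then show "\<exists>v\<ge>0. \<forall>x. norm x \<le> r \<longrightarrow> (\<integral>\<^sup>+\<omega>. ennreal ((deviation x \<omega>)\<^sup>2) \<partial>M) \<le> ennreal v"
      using b c L by (intro deviation_sq_local[OF int, of r "(\<kappa> + \<tau> * (4 * L)) * b + \<sigma>\<^sup>2"]) auto
  qed
qed

text \<open>Common to the second and third settings: the bound \<Delta> keeps position steps inside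
  the smoothness radius, and makes the descent error linear in grad F, hence linear in W.\<close>

context
  fixes L0 L1 \<Delta> c
  assumes sm: "L0L1_smooth L0 L1 F" and \<Delta>: "0 < \<Delta>" "\<And>y. norm (grad \<phi> y) \<le> \<Delta>"
  defines "c \<equiv> L0 / L1 + 8 * L1"
begin

lemma constants: "0 \<le> L0" "0 < L1" "0 \<le> c"
  using sm by (auto simp: L0L1_smooth_def c_def)

lemma grad_F_le: "norm (grad F x) \<le> c * (1 + (F x - Fstar))"
proof -
  have "norm (grad F x) \<le> L0 / L1 + 8 * L1 * (F x - Fstar)"
    by (rule L0L1_smooth_grad_le[OF sm F_lower])
  moreover have "0 \<le> L0 / L1 * (F x - Fstar)" using constants F_lower[of x] by auto
  ultimately show ?thesis using constants by (simp add: c_def algebra_simps)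
qed

lemma grad_F_le_W: "norm (grad F x) \<le> c * W x y"
  using grad_F_le[of x] mult_left_mono[OF W_ge(3)[of x y] constants(3)] by linarith

lemma descent_bounded_grad:
  assumes a: "0 \<le> a" "a \<le> 1 / (L1 * \<Delta>)"
  shows "F (x + a *\<^sub>R grad \<phi> y) \<le> F x + a * inner (grad F x) (grad \<phi> y) + (L0 + L1 * c) * \<Delta>\<^sup>2 * a\<^sup>2 * W x y"
proof -
  have n: "norm (a *\<^sub>R grad \<phi> y) \<le> a * \<Delta>" using a \<Delta>(2)[of y] by (simp add: mult_left_mono)
  also have "\<dots> \<le> 1 / (L1 * \<Delta>) * \<Delta>" using a \<Delta> by (intro mult_right_mono) auto
  finally have "norm (a *\<^sub>R grad \<phi> y) \<le> 1 / L1" using \<Delta> by simp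
  from L0L1_smooth_descent[OF sm this, of x]
  have "F (x + a *\<^sub>R grad \<phi> y) \<le> F x + a * inner (grad F x) (grad \<phi> y)
      + (L0 + L1 * norm (grad F x)) * (norm (a *\<^sub>R grad \<phi> y))\<^sup>2" by simp
  also have "(L0 + L1 * norm (grad F x)) * (norm (a *\<^sub>R grad \<phi> y))\<^sup>2
      \<le> ((L0 + L1 * c) * W x y) * (a * \<Delta>)\<^sup>2"
  proof (intro mult_mono power_mono n)
    have "L0 * 1 \<le> L0 * W x y" using constants W_ge(1) by (intro mult_left_mono) auto
    moreover have "L1 * norm (grad F x) \<le> L1 * (c * W x y)" using constants grad_F_le_W by (intro mult_left_mono) auto
    ultimately show "L0 + L1 * norm (grad F x) \<le> (L0 + L1 * c) * W x y" by (simp add: algebra_simps)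
    show "0 \<le> (L0 + L1 * c) * W x y" using constants W_ge(1)[of x y] by auto
  qed auto
  finally show ?thesis by (simp add: algebra_simps power_mult_distrib)
qed

text \<open>With deviation n, u the norm of grad F x and E = \<gamma> \<Delta>, the cross term is at
  most n^2 + (u + 2E) n + (u + E) E. Since u is linear in W and the mean of n^2 is bounded by a
  constant, the mean of each summand is linear in W.\<close>

lemma controlled_bounded_variance:
  assumes int: "\<And>x. integrable M (\<lambda>\<omega>. (norm (g x (\<xi> \<omega>)))\<^sup>2)"
    and var: "\<And>x. grad_variance M \<xi> F g x \<le> \<sigma>\<^sup>2"
  shows "\<exists>C a0. controlled C a0"
proof -
  define E where "E = \<gamma> * \<Delta>"
  have E: "0 \<le> E" using \<gamma> \<Delta> by (simp add: E_def)
  define D where "D = \<sigma>\<^sup>2 + (c + 2 * E) * (1 + \<sigma>\<^sup>2) + (c + E) * E"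
  define B where "B x \<omega> = (deviation x \<omega>)\<^sup>2 + (norm (grad F x) + 2 * E) * (1 + (deviation x \<omega>)\<^sup>2) + (norm (grad F x) + E) * E" for x \<omega>
  have RB: "cross_term x y \<omega> \<le> B x \<omega>" for x y \<omega>
  proof -
    define n where "n = deviation x \<omega>"
    define u where "u = norm (grad F x)"
    have n: "0 \<le> n" "0 \<le> u" using deviation_nonneg by (auto simp: n_def u_def)
    have "\<gamma> * norm (grad \<phi> y) \<le> E" using \<gamma> \<Delta> by (simp add: E_def)
    moreover have "0 \<le> \<gamma> * norm (grad \<phi> y)" using \<gamma> by simp
    ultimately have "(n + u + \<gamma> * norm (grad \<phi> y)) * (n + \<gamma> * norm (grad \<phi> y)) \<le> (n + u + E) * (n + E)"
      using n E by (intro mult_mono) auto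
    moreover have "cross_term x y \<omega> \<le> (n + u + \<gamma> * norm (grad \<phi> y)) * (n + \<gamma> * norm (grad \<phi> y))"
      unfolding n_def u_def by (rule cross_term_le)
    moreover have "(u + 2 * E) * n \<le> (u + 2 * E) * (1 + n\<^sup>2)"
    proof (rule mult_left_mono)
      have "0 \<le> (n - 1 / 2)\<^sup>2" by simp
      then show "n \<le> 1 + n\<^sup>2" by (simp add: power2_eq_square algebra_simps)
    qed (use n E in auto)
    ultimately show ?thesis by (simp add: B_def n_def[symmetric] u_def[symmetric] power2_eq_square algebra_simps)
  qed
  have Bi: "integrable M (B x)" for x
    unfolding B_def[abs_def] using deviation_sq(1)[OF int] by auto
  have BW: "(\<integral>\<omega>. B x \<omega> \<partial>M) \<le> D * W x y" for x y
  proof -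
    define w where "w = W x y"
    have w: "1 \<le> w" "norm (grad F x) \<le> c * w" unfolding w_def by (rule W_ge grad_F_le_W)+
    have e: "E * 1 \<le> E * w" "\<sigma>\<^sup>2 * 1 \<le> \<sigma>\<^sup>2 * w" using w E by (intro mult_left_mono; simp)+
    have "(\<integral>\<omega>. B x \<omega> \<partial>M) = grad_variance M \<xi> F g x
        + (norm (grad F x) + 2 * E) * (1 + grad_variance M \<xi> F g x) + (norm (grad F x) + E) * E"
      unfolding B_def using deviation_sq[OF int] by (simp add: prob_space)
    also have "\<dots> \<le> \<sigma>\<^sup>2 * w + ((c + 2 * E) * w) * (1 + \<sigma>\<^sup>2) + ((c + E) * w) * E"
    proof (intro add_mono mult_mono)
      show "grad_variance M \<xi> F g x \<le> \<sigma>\<^sup>2 * w" using var[of x] e by linarith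
      show "norm (grad F x) + 2 * E \<le> (c + 2 * E) * w" "norm (grad F x) + E \<le> (c + E) * w"
        using w e by (simp_all add: algebra_simps)
      \<comment> \<open>\<open>grad_variance\<close> is a difference; its sign is read off from the
        integral of the squared deviation.\<close>
      show "0 \<le> 1 + grad_variance M \<xi> F g x"
        using deviation_sq(2)[OF int, of x] Bochner_Integration.integral_nonneg[of M "\<lambda>\<omega>. (deviation x \<omega>)\<^sup>2"] by simp
    qed (use var E w constants in auto)
    also have "\<dots> = D * w" by (simp add: D_def algebra_simps)
    finally show ?thesis by (simp add: w_def)
  qed
  show ?thesis
  proof (rule controlledI[OF _ _ _ descent_bounded_grad])
    show "0 \<le> (L0 + L1 * c) * \<Delta>\<^sup>2" "0 \<le> D" "0 < 1 / (L1 * \<Delta>)" using constants \<Delta> E by (auto simp: D_def)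
    show "integrable M (cross_term x y)" for x y by (rule cross_term_integral_le(1)[OF Bi RB])
    show "(\<integral>\<omega>. cross_term x y \<omega> \<partial>M) \<le> D * W x y" for x y
      using cross_term_integral_le(2)[OF Bi RB, of x y] BW[of x y] by linarith
    show "\<exists>v\<ge>0. \<forall>x. norm x \<le> r \<longrightarrow> (\<integral>\<^sup>+\<omega>. ennreal ((deviation x \<omega>)\<^sup>2) \<partial>M) \<le> ennreal v" for r
      using var by (intro deviation_sq_local[OF int, of r "\<sigma>\<^sup>2"]) auto
  qed
qed

text \<open>The first factor of the cross term is bounded pointwise by a multiple of W and leaves
  the integral, so a first moment suffices for the second. The pointwise bound also bounds the
  deviation on balls, which gives the local variance.\<close>

lemma controlled_pointwise_bound:
  assumes c': "0 \<le> c'" and bound: "\<And>x \<omega>. \<omega> \<in> space M \<Longrightarrow> norm (g x (\<xi> \<omega>)) \<le> c' * (1 + (F x - Fstar))"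
    and \<sigma>: "0 \<le> \<sigma>" and dev_le: "\<And>x. (\<integral>\<omega>. deviation x \<omega> \<partial>M) \<le> \<sigma>"
  shows "\<exists>C a0. controlled C a0"
proof -
  define E where "E = \<gamma> * \<Delta>"
  have E: "0 \<le> E" using \<gamma> \<Delta> by (simp add: E_def)
  define B where "B x y \<omega> = ((c' + E) * W x y) * (deviation x \<omega> + E)" for x y \<omega>
  have RB: "cross_term x y \<omega> \<le> B x y \<omega>" if "\<omega> \<in> space M" for x y \<omega>
    unfolding cross_term_def B_def deviation_def
  proof (intro mult_mono add_mono order_refl)
    have e: "norm (\<gamma> *\<^sub>R grad \<phi> y) \<le> E" using \<gamma> \<Delta> by (simp add: E_def)
    then show "\<gamma> * norm (grad \<phi> y) \<le> E" using \<gamma> by simp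
    have "norm (g x (\<xi> \<omega>)) \<le> c' * W x y"
      using bound[OF that, of x] mult_left_mono[OF W_ge(3)[of x y] c'] by linarith
    moreover have "E * 1 \<le> E * W x y" using E W_ge(1) by (intro mult_left_mono) auto
    moreover have "norm (g x (\<xi> \<omega>) + \<gamma> *\<^sub>R grad \<phi> y) \<le> norm (g x (\<xi> \<omega>)) + norm (\<gamma> *\<^sub>R grad \<phi> y)"
      by (rule norm_triangle_ineq)
    ultimately show "norm (g x (\<xi> \<omega>) + \<gamma> *\<^sub>R grad \<phi> y) \<le> (c' + E) * W x y"
      using e by (simp add: algebra_simps)
    show "0 \<le> (c' + E) * W x y" using c' E W_ge(1)[of x y] by auto
    show "0 \<le> norm (grad F x - g x (\<xi> \<omega>)) + \<gamma> * norm (grad \<phi> y)" using \<gamma> by auto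
  qed
  have Bi: "integrable M (B x y)" for x y
    unfolding B_def[abs_def] using deviation_int[of x] by auto
  have BW: "(\<integral>\<omega>. B x y \<omega> \<partial>M) \<le> (c' + E) * (\<sigma> + E) * W x y" for x y
  proof -
    have "(\<integral>\<omega>. B x y \<omega> \<partial>M) = ((c' + E) * W x y) * ((\<integral>\<omega>. deviation x \<omega> \<partial>M) + E)"
      unfolding B_def using deviation_int[of x] by (simp add: prob_space)
    also have "\<dots> \<le> ((c' + E) * W x y) * (\<sigma> + E)"
      using dev_le[of x] c' E W_ge(1)[of x y] by (intro mult_left_mono) auto
    finally show ?thesis by (simp add: algebra_simps)
  qed
  show ?thesis
  proof (rule controlledI[OF _ _ _ descent_bounded_grad])
    show "0 \<le> (L0 + L1 * c) * \<Delta>\<^sup>2" "0 \<le> (c' + E) * (\<sigma> + E)" "0 < 1 / (L1 * \<Delta>)" using constants \<Delta> E c' \<sigma> by auto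
    show "integrable M (cross_term x y)" for x y by (rule cross_term_integral_le(1)[OF Bi RB])
    show "(\<integral>\<omega>. cross_term x y \<omega> \<partial>M) \<le> (c' + E) * (\<sigma> + E) * W x y" for x y
      using cross_term_integral_le(2)[OF Bi RB, of x y] BW[of x y] by linarith
    fix r
    obtain b where b: "0 \<le> b" "\<And>x. norm x \<le> r \<Longrightarrow> F x - Fstar \<le> b" using F_local_bound by blast
    show "\<exists>v\<ge>0. \<forall>x. norm x \<le> r \<longrightarrow> (\<integral>\<^sup>+\<omega>. ennreal ((deviation x \<omega>)\<^sup>2) \<partial>M) \<le> ennreal v"
    proof (intro exI[of _ "((c + c') * (1 + b))\<^sup>2"] conjI allI impI)
      fix x :: 'a assume x: "norm x \<le> r"
      have "deviation x \<omega> \<le> (c + c') * (1 + b)" if "\<omega> \<in> space M" for \<omega>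
      proof -
        have "deviation x \<omega> \<le> norm (grad F x) + norm (g x (\<xi> \<omega>))" unfolding deviation_def by (rule norm_triangle_ineq4)
        also have "\<dots> \<le> (c + c') * (1 + (F x - Fstar))"
          using grad_F_le[of x] bound[OF that, of x] by (simp add: distrib_right)
        also have "\<dots> \<le> (c + c') * (1 + b)" using b(2)[OF x] constants c' by (intro mult_left_mono) auto
        finally show ?thesis .
      qed
      then have "(\<integral>\<^sup>+\<omega>. ennreal ((deviation x \<omega>)\<^sup>2) \<partial>M) \<le> (\<integral>\<^sup>+\<omega>. ennreal (((c + c') * (1 + b))\<^sup>2) \<partial>M)"
        using deviation_nonneg by (intro nn_integral_mono ennreal_leI power_mono) auto
      then show "(\<integral>\<^sup>+\<omega>. ennreal ((deviation x \<omega>)\<^sup>2) \<partial>M) \<le> ennreal (((c + c') * (1 + b))\<^sup>2)"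
        by (simp add: emeasure_space_1)
    qed simp
  qed
qed

end

end

section \<open>Mini-batch gradients\<close>

lemma grad_mean:
  fixes f :: "nat \<Rightarrow> 'a::euclidean_space \<Rightarrow> real"
  assumes "\<And>i. i \<in> B \<Longrightarrow> f i differentiable (at x)"
  shows "grad (\<lambda>x. c * (\<Sum>i\<in>B. f i x)) x = c *\<^sub>R (\<Sum>i\<in>B. grad (f i) x)"
proof (rule grad_eq)
  have "((\<lambda>x. c * (\<Sum>i\<in>B. f i x)) has_derivative (\<lambda>h. c * (\<Sum>i\<in>B. inner h (grad (f i) x)))) (at x)"
    using GDERIV_grad[OF assms] unfolding gderiv_def
    by (intro has_derivative_mult_right has_derivative_sum) auto
  then show "GDERIV (\<lambda>x. c * (\<Sum>i\<in>B. f i x)) x :> c *\<^sub>R (\<Sum>i\<in>B. grad (f i) x)"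
    by (simp add: gderiv_def inner_sum_right)
qed

text \<open>
  All summands being bounded below, the gap of a batch is at most \<open>N\<close> times the gap of \<open>F\<close>, up to a
  constant; so the gradients of all batches are controlled by the gap of \<open>F\<close> alone.
\<close>

lemma batch_grad_bound:
  fixes f :: "nat \<Rightarrow> 'a::euclidean_space \<Rightarrow> real" and N :: nat
  assumes N: "1 \<le> N" and lower: "\<And>x. Fstar \<le> F x"
    and diff: "\<And>i x. i \<in> {1..N} \<Longrightarrow> f i differentiable (at x)"
    and bdd: "\<And>i. i \<in> {1..N} \<Longrightarrow> bdd_below (range (f i))"
    and F: "\<And>x. F x = (1 / real N) * (\<Sum>i\<in>{1..N}. f i x)"
  obtains c where "0 \<le> c" "\<And>B x. B \<subseteq> {1..N} \<Longrightarrow> B \<noteq> {} \<Longrightarrow>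
      L0L1_smooth L0 L1 (\<lambda>x. (1 / real (card B)) * (\<Sum>i\<in>B. f i x)) \<Longrightarrow>
      norm ((1 / real (card B)) *\<^sub>R (\<Sum>i\<in>B. grad (f i) x)) \<le> c * (1 + (F x - Fstar))"
proof -
  define m where "m i = (INF x. f i x)" for i
  have m: "m i \<le> f i x" if "i \<in> {1..N}" for i x
    unfolding m_def using bdd[OF that] by (intro cINF_lower) auto
  define e where "e = real N * Fstar - (\<Sum>i\<in>{1..N}. m i)"
  have gap: "(\<Sum>i\<in>{1..N}. f i x - m i) \<le> (real N + \<bar>e\<bar>) * (1 + (F x - Fstar))" for x
  proof -
    have "(\<Sum>i\<in>{1..N}. f i x - m i) = real N * F x - (\<Sum>i\<in>{1..N}. m i)"
      using N by (simp add: F sum_subtractf)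
    also have "\<dots> = real N * (F x - Fstar) + e" by (simp add: e_def algebra_simps)
    also have "\<dots> \<le> (real N + \<bar>e\<bar>) * (1 + (F x - Fstar))"
    proof -
      have "0 \<le> \<bar>e\<bar> * (F x - Fstar)" using lower[of x] by simp
      then show ?thesis by (simp add: algebra_simps)
    qed
    finally show ?thesis .
  qed
  \<comment> \<open>One c serves all batches, so it is fixed before any smoothness assumption
    determines the signs of L0 and L1; hence the maxima.\<close>
  define c where "c = max 0 (L0 / L1) + 8 * max 0 L1 * (real N + \<bar>e\<bar>)"
  show thesis
  proof (rule that[of c])
    show "0 \<le> c" by (auto simp: c_def)
    fix B x assume B: "B \<subseteq> {1..N}" "B \<noteq> {}"
      and sm: "L0L1_smooth L0 L1 (\<lambda>x. (1 / real (card B)) * (\<Sum>i\<in>B. f i x))"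
    have L: "0 \<le> L0" "0 < L1" using sm by (auto simp: L0L1_smooth_def)
    have fin: "finite B" using B(1) finite_subset by blast
    then have card: "1 \<le> real (card B)" using B(2) by (simp add: Suc_le_eq card_gt_0_iff)
    have "norm ((1 / real (card B)) *\<^sub>R (\<Sum>i\<in>B. grad (f i) x))
        = norm (grad (\<lambda>x. (1 / real (card B)) * (\<Sum>i\<in>B. f i x)) x)"
      using diff B(1) by (subst grad_mean) auto
    also have "\<dots> \<le> L0 / L1 + 8 * L1 * ((1 / real (card B)) * (\<Sum>i\<in>B. f i x) - (1 / real (card B)) * (\<Sum>i\<in>B. m i))"
      using m B(1) by (intro L0L1_smooth_grad_le[OF sm] mult_left_mono sum_mono) auto
    also have "(1 / real (card B)) * (\<Sum>i\<in>B. f i x) - (1 / real (card B)) * (\<Sum>i\<in>B. m i)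
        = (1 / real (card B)) * (\<Sum>i\<in>B. f i x - m i)" by (simp add: sum_subtractf diff_divide_distrib)
    also have "\<dots> \<le> (\<Sum>i\<in>B. f i x - m i)"
      using card m B(1) by (intro mult_left_le_one_le sum_nonneg) auto
    also have "\<dots> \<le> (\<Sum>i\<in>{1..N}. f i x - m i)" using B m by (intro sum_mono2) auto
    also have "\<dots> \<le> (real N + \<bar>e\<bar>) * (1 + (F x - Fstar))" by (rule gap)
    finally have "norm ((1 / real (card B)) *\<^sub>R (\<Sum>i\<in>B. grad (f i) x))
        \<le> L0 / L1 + 8 * L1 * ((real N + \<bar>e\<bar>) * (1 + (F x - Fstar)))" using L by simp
    also have "\<dots> \<le> c * (1 + (F x - Fstar))"
    proof -
      have "L0 / L1 * 1 \<le> L0 / L1 * (1 + (F x - Fstar))" using L lower[of x] by (intro mult_left_mono) auto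
      then show ?thesis using L by (simp add: c_def max_def algebra_simps)
    qed
    finally show "norm ((1 / real (card B)) *\<^sub>R (\<Sum>i\<in>B. grad (f i) x)) \<le> c * (1 + (F x - Fstar))" .
  qed
qed

theorem theorem6:
  fixes M :: "'w measure" and S :: "'s measure"
    and \<xi> :: "'w \<Rightarrow> 's" and \<xi>s :: "nat \<Rightarrow> 'w \<Rightarrow> 's"
    and F \<phi> :: "real ^ 'd \<Rightarrow> real"
    and g :: "real ^ 'd \<Rightarrow> 's \<Rightarrow> real ^ 'd"
    and \<alpha> :: "nat \<Rightarrow> real" and \<gamma> Fstar :: real
    and q0 :: "real ^ 'd" and p q :: "nat \<Rightarrow> 'w \<Rightarrow> real ^ 'd"
  assumes prob: "prob_space M"
    and indep: "prob_space.indep_vars M (\<lambda>_. S) \<xi>s UNIV"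
    and generic: "\<xi> \<in> measurable M S"
    and identical: "\<And>k. distr M S (\<xi>s k) = distr M S \<xi>"
    and g_measurable: "(\<lambda>(x, s). g x s) \<in> borel_measurable (borel \<Otimes>\<^sub>M S)"
    and F_diff: "\<And>x. F differentiable (at x)"
    and \<phi>_diff: "\<And>x. \<phi> differentiable (at x)"
    and \<gamma>: "\<gamma> > 0"
    and p_0: "\<And>\<omega>. \<omega> \<in> space M \<Longrightarrow> p 0 \<omega> = 0"
    and q_0: "\<And>\<omega>. \<omega> \<in> space M \<Longrightarrow> q 0 \<omega> = q0"
    and p_Suc: "\<And>k \<omega>. \<omega> \<in> space M \<Longrightarrow>
      p (Suc k) \<omega> = p k \<omega> - \<alpha> k *\<^sub>R g (q k \<omega>) (\<xi>s k \<omega>) - (\<alpha> k * \<gamma>) *\<^sub>R grad \<phi> (p k \<omega>)"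
    and q_Suc: "\<And>k \<omega>. \<omega> \<in> space M \<Longrightarrow>
      q (Suc k) \<omega> = q k \<omega> + \<alpha> k *\<^sub>R grad \<phi> (p (Suc k) \<omega>)"
    and F_coercive: "filterlim F at_top at_infinity"
    and F_bound: "\<And>x. F x \<ge> Fstar"
    and F_critical_values: "\<And>K. compact K \<Longrightarrow> finite (F ` stationary_points F \<inter> K)"
    and unbiased: "\<And>x. has_bochner_integral M (\<lambda>\<omega>. g x (\<xi> \<omega>)) (grad F x)"
    and \<phi>_smooth: "\<exists>l>0. \<forall>x y. norm (grad \<phi> y - grad \<phi> x) \<le> l * norm (x - y)"
    and \<phi>_convex: "\<And>x y. \<phi> y - \<phi> x \<le> inner (grad \<phi> y) (y - x)"
    and \<phi>_coercive: "filterlim \<phi> at_top at_infinity"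
    and \<phi>_bound: "bdd_below (range \<phi>)"
    and \<alpha>_0: "\<alpha> 0 = 0"
    and \<alpha>_pos: "\<And>k. k \<ge> 1 \<Longrightarrow> \<alpha> k > 0"
    and \<alpha>_sum: "filterlim (\<lambda>n. \<Sum>k<n. \<alpha> k) at_top sequentially"
    and \<alpha>_sq_sum: "summable (\<lambda>k. (\<alpha> k)\<^sup>2)"
    and settings: "setting1 M \<xi> F Fstar g \<or> setting2 M \<xi> F \<phi> g \<or> setting3 M S \<xi> F \<phi> g"
  shows "(AE \<omega> in M. (\<lambda>k. infdist (q k \<omega>) (stationary_points F)) \<longlonglongrightarrow> 0) \<and>
    ((\<forall>x\<in>stationary_points F. x isolated_in stationary_points F) \<longrightarrow>
       (AE \<omega> in M. \<exists>x\<in>stationary_points F. (\<lambda>k. q k \<omega>) \<longlonglongrightarrow> x))"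
proof -
  obtain l where l: "0 < l" "\<And>x y. norm (grad \<phi> y - grad \<phi> x) \<le> l * norm (x - y)"
    using \<phi>_smooth by blast
  define \<phi>star where "\<phi>star = (INF x. \<phi> x)"
  have \<phi>_lower: "\<phi>star \<le> \<phi> x" for x
    unfolding \<phi>star_def using \<phi>_bound by (intro cINF_lower) auto
  interpret prob_space M by (rule prob)
  interpret E: energy_setup M \<xi> F \<phi> g \<gamma> Fstar \<phi>star l
    "\<lambda>x y. 1 + (F x - Fstar) + (\<phi> y - \<phi>star)"
    by unfold_locales (fact F_diff \<phi>_diff \<gamma> F_bound unbiased l \<phi>_lower)+
  \<comment> \<open>The three settings merge here: the rest of the proof sees only this continuity
    and the constants C and a0.\<close>
  have "continuous_on UNIV (grad F) \<and> (\<exists>C a0. E.controlled C a0)"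
    using settings
  proof (elim disjE)
    assume "setting1 M \<xi> F Fstar g"
    then obtain L \<kappa> \<tau> \<sigma> where L: "0 < L" "\<And>x y. norm (grad F y - grad F x) \<le> L * norm (x - y)"
      and c: "0 \<le> \<kappa>" "0 \<le> \<tau>" and var: "\<And>x. integrable M (\<lambda>\<omega>. (norm (g x (\<xi> \<omega>)))\<^sup>2)"
        "\<And>x. grad_variance M \<xi> F g x \<le> \<kappa> * (F x - Fstar) + \<tau> * (norm (grad F x))\<^sup>2 + \<sigma>\<^sup>2"
      unfolding setting1_def by blast
    show ?thesis
      using L0L1_smooth_continuous_grad[OF L0L1_smooth_of_lipschitz[OF F_diff L(2,1)]]
        E.controlled_lipschitz[OF L c var] by blast
  next
    assume "setting2 M \<xi> F \<phi> g"
    then obtain L0 L1 \<sigma> \<Delta> where sm: "L0L1_smooth L0 L1 F"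
      and var: "\<And>x. integrable M (\<lambda>\<omega>. (norm (g x (\<xi> \<omega>)))\<^sup>2)" "\<And>x. grad_variance M \<xi> F g x \<le> \<sigma>\<^sup>2"
      and \<Delta>: "0 < \<Delta>" "\<And>x. norm (grad \<phi> x) \<le> \<Delta>"
      unfolding setting2_def by blast
    show ?thesis
      using L0L1_smooth_continuous_grad[OF sm] E.controlled_bounded_variance[OF sm \<Delta> var] by blast
  next
    assume "setting3 M S \<xi> F \<phi> g"
    then obtain \<Delta> \<sigma> L0 L1 and N :: nat and f :: "nat \<Rightarrow> real ^ 'd \<Rightarrow> real" and B :: "'s \<Rightarrow> nat set"
      where \<Delta>: "0 < \<Delta>" "\<And>x. norm (grad \<phi> x) \<le> \<Delta>"
      and \<sigma>: "0 \<le> \<sigma>" "\<And>x. (\<integral>\<omega>. norm (g x (\<xi> \<omega>) - grad F x) \<partial>M) \<le> \<sigma>"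
      and sm: "L0L1_smooth L0 L1 F" and N: "1 \<le> N"
      and f: "\<And>i x. i \<in> {1..N} \<Longrightarrow> f i differentiable (at x)"
        "\<And>i. i \<in> {1..N} \<Longrightarrow> bdd_below (range (f i))"
      and F: "\<And>x. F x = (1 / real N) * (\<Sum>i\<in>{1..N}. f i x)"
      and B: "\<And>s. s \<in> space S \<Longrightarrow> B s \<subseteq> {1..N} \<and> B s \<noteq> {}"
        "\<And>s x. s \<in> space S \<Longrightarrow> g x s = (1 / real (card (B s))) *\<^sub>R (\<Sum>i\<in>B s. grad (f i) x)"
        "\<And>s. s \<in> space S \<Longrightarrow> L0L1_smooth L0 L1 (\<lambda>x. (1 / real (card (B s))) * (\<Sum>i\<in>B s. f i x))"
      unfolding setting3_def by metis
    obtain c where c: "0 \<le> c" "\<And>B x. B \<subseteq> {1..N} \<Longrightarrow> B \<noteq> {} \<Longrightarrow>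
        L0L1_smooth L0 L1 (\<lambda>x. (1 / real (card B)) * (\<Sum>i\<in>B. f i x)) \<Longrightarrow>
        norm ((1 / real (card B)) *\<^sub>R (\<Sum>i\<in>B. grad (f i) x)) \<le> c * (1 + (F x - Fstar))"
      using batch_grad_bound[OF N F_bound f F] by blast
    \<comment> \<open>The sample enters only through its batch, so one constant bounds the gradients
      of all samples.\<close>
    have "norm (g x (\<xi> \<omega>)) \<le> c * (1 + (F x - Fstar))" if "\<omega> \<in> space M" for x \<omega>
    proof -
      have s: "\<xi> \<omega> \<in> space S" using measurable_space[OF generic that] .
      show ?thesis unfolding B(2)[OF s] using B(1)[OF s] by (intro c(2) B(3)[OF s]) auto
    qed
    moreover have "(\<integral>\<omega>. E.deviation x \<omega> \<partial>M) \<le> \<sigma>" for x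
      using \<sigma>(2)[of x] by (simp add: E.deviation_def norm_minus_commute)
    ultimately show ?thesis
      using L0L1_smooth_continuous_grad[OF sm] E.controlled_pointwise_bound[OF sm \<Delta> c(1) _ \<sigma>(1)] by blast
  qed
  then obtain C a0 where cont: "continuous_on UNIV (grad F)" and C: "E.controlled C a0" by blast
  have \<alpha>_nonneg: "0 \<le> \<alpha> k" for k
    using \<alpha>_0 \<alpha>_pos[of k] by (cases k) auto
  note C' = C[unfolded E.controlled_def E.cross_term_def[abs_def] E.deviation_def]
  have C0: "0 \<le> C" "0 < a0"
    and descent: "\<And>a x y. 0 \<le> a \<Longrightarrow> a \<le> a0 \<Longrightarrow> F (x + a *\<^sub>R grad \<phi> y)
      \<le> F x + a * inner (grad F x) (grad \<phi> y) + C * a\<^sup>2 * (1 + (F x - Fstar) + (\<phi> y - \<phi>star))"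
    and growth: "\<And>x y. integrable M (\<lambda>\<omega>. norm (g x (\<xi> \<omega>) + \<gamma> *\<^sub>R grad \<phi> y)
        * (norm (grad F x - g x (\<xi> \<omega>)) + \<gamma> * norm (grad \<phi> y)))"
      "\<And>x y. (\<integral>\<omega>. norm (g x (\<xi> \<omega>) + \<gamma> *\<^sub>R grad \<phi> y)
        * (norm (grad F x - g x (\<xi> \<omega>)) + \<gamma> * norm (grad \<phi> y)) \<partial>M)
        \<le> C * (1 + (F x - Fstar) + (\<phi> y - \<phi>star))"
    and var: "\<And>r. \<exists>v\<ge>0. \<forall>x. norm x \<le> r \<longrightarrow>
      (\<integral>\<^sup>+\<omega>. ennreal ((norm (grad F x - g x (\<xi> \<omega>)))\<^sup>2) \<partial>M) \<le> ennreal v"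
    using C' by auto
  interpret H: hamiltonian_scheme M S \<xi> \<xi>s F \<phi> g \<alpha> \<gamma> Fstar \<phi>star l C a0 p q q0
    "\<lambda>x y. 1 + (F x - Fstar) + (\<phi> y - \<phi>star)"
    by unfold_locales
      (fact indep generic identical g_measurable F_diff \<phi>_diff \<gamma> p_0 q_0 p_Suc q_Suc F_coercive F_bound
        unbiased l \<phi>_convex \<phi>_coercive \<phi>_lower \<alpha>_nonneg \<alpha>_sum \<alpha>_sq_sum cont C0 descent growth var)+
  show ?thesis using H.stationary_AE by blast
qed

end
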